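(* Let $V$ be a $C_2$-cofinite simple vertex operator algebra of CFT type, and suppose that $V$ is strongly generated by a finite subset $T\subset \bigcup_{d=1}^\infty V_d$. Then $\widetilde{V}=(V\otimes V)^\sigma$ is $C_2$-cofinite if and only if the subspace of $\widetilde{V}/C_2(\widetilde{V})$ spanned by $\{\overline{\eta}(x_{(-n)}y) \mid x,y\in T,\ n\geq 1\}$ is finite dimensional.
   Context: All vector spaces are over $\mathbb{C}$. A vertex operator algebra $V=\bigoplus_{d=0}^\infty V_d$ has $n$-th products $(a,b)\mapsto a_{(n)}b$ ($n\in\mathbb{Z}$), vacuum vector $\mathbf{1}\in V_0$ and Virasoro vector $\omega\in V_2$; $V_d$ is the weight-$d$ space. $V$ is of CFT type if $V_0=\mathbb{C}\mathbf{1}$. For a vertex operator algebra $W$, $C_2(W)$ is the span of $\{a_{(-2)}b\mid a,b\in W\}$, and $W$ is $C_2$-cofinite if $W/C_2(W)$ is finite dimensional. $V$ is strongly generated by $T\subset V$ if $V$ is spanned by $\mathbf{1}$ and the vectors $a^1_{(-n_1)}\cdots a^r_{(-n_r)}\mathbf{1}$ with $r\geq 1$, $a^i\in T$, $n_i\geq 1$. $V\otimes V$ is the tensor product vertex operator algebra, with vacuum $\mathbf{1}\otimes\mathbf{1}$, Virasoro vector $\omega\otimes\mathbf{1}+\mathbf{1}\otimes\omega$ and products $(a\otimes b)_{(n)}(u\otimes v)=\sum_{i\in\mathbb{Z}}(a_{(i)}u)\otimes(b_{(n-1-i)}v)$. The map $\sigma(a\otimes b)=b\otimes a$ is an automorphism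 of $V\otimes V$ of order $2$, and $\widetilde{V}:=(V\otimes V)^\sigma$ is the vertex operator subalgebra of $\sigma$-fixed points. For $a\in V$, $\eta(a)=a\otimes\mathbf{1}+\mathbf{1}\otimes a\in\widetilde{V}$, and $\overline{\eta}(a)$ is the image of $\eta(a)$ in $\widetilde{V}/C_2(\widetilde{V})$. *)

theory Defs
  imports Complex_Main "HOL-Library.Poly_Mapping" "HOL-Library.Set_Algebras"
begin

section \<open>Complex vector spaces\<close>

class complex_vector = ab_group_add +
  fixes scaleC :: "complex \<Rightarrow> 'a \<Rightarrow> 'a"  (infixr \<open>*\<^sub>C\<close> 75)
  assumes scaleC_add_right: "a *\<^sub>C (x + y) = a *\<^sub>C x + a *\<^sub>C y"
    and scaleC_add_left: "(a + b) *\<^sub>C x = a *\<^sub>C x + b *\<^sub>C x"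
    and scaleC_scaleC: "a *\<^sub>C b *\<^sub>C x = (a * b) *\<^sub>C x"
    and scaleC_one: "1 *\<^sub>C x = x"

global_interpretation complex_vector: vector_space "scaleC :: complex \<Rightarrow> 'a \<Rightarrow> 'a::complex_vector"
  by unfold_locales (simp_all add: scaleC_add_right scaleC_add_left scaleC_scaleC scaleC_one)

abbreviation clinear :: "('a::complex_vector \<Rightarrow> 'b::complex_vector) \<Rightarrow> bool"
  where "clinear \<equiv> Vector_Spaces.linear scaleC scaleC"

abbreviation cspan :: "'a::complex_vector set \<Rightarrow> 'a set"
  where "cspan \<equiv> complex_vector.span"

abbreviation csubspace :: "'a::complex_vector set \<Rightarrow> bool"
  where "csubspace \<equiv> complex_vector.subspace"

definition cbilinear :: "('a::complex_vector \<Rightarrow> 'b::complex_vector \<Rightarrow> 'c::complex_vector) \<Rightarrow> bool"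
  where "cbilinear f \<longleftrightarrow> (\<forall>b. clinear (\<lambda>a. f a b)) \<and> (\<forall>a. clinear (f a))"

lemma clinearI:
  assumes "\<And>x y. f (x + y) = f x + f y" "\<And>c x. f (c *\<^sub>C x) = c *\<^sub>C f x"
  shows "clinear f"
  by unfold_locales (use assms in \<open>auto simp: scaleC_add_right scaleC_add_left scaleC_scaleC scaleC_one\<close>)

lemma clinear_add: "clinear f \<Longrightarrow> f (x + y) = f x + f y"
  and clinear_scale: "clinear f \<Longrightarrow> f (c *\<^sub>C x) = c *\<^sub>C f x"
  unfolding Vector_Spaces.linear_def by (blast dest: module_hom.add module_hom.scale)+

lemma clinear_0: "clinear f \<Longrightarrow> f 0 = 0"
  using clinear_add[of f 0 0] by simp

lemma clinear_diff: "clinear f \<Longrightarrow> f (x - y) = f x - f y"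
  using clinear_add[of f "x - y" y] by (simp add: algebra_simps)

lemma clinear_eq_0_on_span:
  assumes "clinear f" "\<And>x. x \<in> S \<Longrightarrow> f x = 0" "x \<in> cspan S"
  shows "f x = 0"
  using assms(3)
  by (induction rule: complex_vector.span_induct_alt)
    (simp_all add: assms clinear_0 clinear_add clinear_scale)


section \<open>Quotient spaces\<close>

text \<open>
  For subspaces \<open>U \<subseteq> W\<close>, the elements of \<open>W / U\<close> are the cosets \<open>w +o U\<close>. Addition of cosets is the
  sum of sets from \<open>HOL-Library.Set_Algebras\<close> and \<open>U\<close> is the zero vector.
\<close>

definition quotient_space :: "'a::complex_vector set \<Rightarrow> 'a set \<Rightarrow> 'a set set"
  where "quotient_space W U = (\<lambda>w. w +o U) ` W"

text \<open>The summand \<open>U\<close> only matters for \<open>c = 0\<close>, where the image of \<open>X\<close> is not a coset.\<close>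

definition coset_scale :: "'a::complex_vector set \<Rightarrow> complex \<Rightarrow> 'a set \<Rightarrow> 'a set"
  where "coset_scale U c X = (\<lambda>x. c *\<^sub>C x) ` X + U"

lemma coset_add:
  assumes "csubspace U"
  shows "(a +o U) + (b +o U) = (a + b) +o U"
proof -
  have "U + U = U"
  proof
    show "U + U \<subseteq> U"
      using assms complex_vector.subspace_add by (auto simp: set_plus_def)
    show "U \<subseteq> U + U"
      using complex_vector.subspace_0[OF assms] by (force simp: set_plus_def)
  qed
  then show ?thesis
    by (metis set_plus_rearrange)
qed

lemma coset_scale:
  assumes "csubspace U"
  shows "coset_scale U c (a +o U) = (c *\<^sub>C a) +o U"
proof
  show "coset_scale U c (a +o U) \<subseteq> (c *\<^sub>C a) +o U"
  proof
    fix x assume "x \<in> coset_scale U c (a +o U)"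
    then obtain u v where uv: "u \<in> U" "v \<in> U" "x = c *\<^sub>C (a + u) + v"
      by (auto simp: coset_scale_def set_plus_def elt_set_plus_def)
    then have "c *\<^sub>C u + v \<in> U"
      by (simp add: assms complex_vector.subspace_add complex_vector.subspace_scale)
    with uv show "x \<in> (c *\<^sub>C a) +o U"
      by (auto simp: elt_set_plus_def scaleC_add_right add.assoc)
  qed
  show "(c *\<^sub>C a) +o U \<subseteq> coset_scale U c (a +o U)"
    using complex_vector.subspace_0[OF assms]
    by (force simp: coset_scale_def set_plus_def elt_set_plus_def)
qed

inductive_set quotient_span :: "'a::complex_vector set \<Rightarrow> 'a set set \<Rightarrow> 'a set set"
  for U :: "'a set" and S :: "'a set set" where
    zero: "U \<in> quotient_span U S"
  | step: "X \<in> S \<Longrightarrow> Y \<in> quotient_span U S \<Longrightarrow> coset_scale U c X + Y \<in> quotient_span U S"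

definition quotient_finite_dim :: "'a::complex_vector set \<Rightarrow> 'a set set \<Rightarrow> bool"
  where "quotient_finite_dim U Q \<longleftrightarrow> (\<exists>F. finite F \<and> F \<subseteq> Q \<and> quotient_span U F = Q)"

lemma quotient_span_cosets:
  assumes U: "csubspace U"
  shows "quotient_span U ((\<lambda>a. a +o U) ` A) = (\<lambda>a. a +o U) ` cspan A"
proof (intro equalityI subsetI)
  fix X assume "X \<in> quotient_span U ((\<lambda>a. a +o U) ` A)"
  then show "X \<in> (\<lambda>a. a +o U) ` cspan A"
  proof induction
    case zero
    have "U = 0 +o U" by (simp add: elt_set_plus_def)
    then show ?case using complex_vector.span_zero by blast
  next
    case (step X Y c)
    then obtain a b where "a \<in> A" "X = a +o U" "b \<in> cspan A" "Y = b +o U"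
      by blast
    then have "coset_scale U c X + Y = (c *\<^sub>C a + b) +o U" "c *\<^sub>C a + b \<in> cspan A"
      by (simp_all add: coset_scale[OF U] coset_add[OF U] complex_vector.span_add
          complex_vector.span_scale complex_vector.span_base)
    then show ?case by blast
  qed
next
  fix X assume "X \<in> (\<lambda>a. a +o U) ` cspan A"
  then obtain a where a: "a \<in> cspan A" and X: "X = a +o U" by blast
  from a have "a +o U \<in> quotient_span U ((\<lambda>a. a +o U) ` A)"
  proof (induction rule: complex_vector.span_induct_alt)
    case base
    have "U = 0 +o U" by (simp add: elt_set_plus_def)
    then show ?case using quotient_span.zero by metis
  next
    case (step c x y)
    from quotient_span.step[OF imageI[OF step(1)] step(2)] show ?case
      by (simp add: coset_scale[OF U] coset_add[OF U])
  qed
  with X show "X \<in> quotient_span U ((\<lambda>a. a +o U) ` A)" by simp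
qed


section \<open>Tensor products\<close>

instantiation complex :: complex_vector
begin
definition scaleC_complex :: "complex \<Rightarrow> complex \<Rightarrow> complex" where "scaleC_complex c x = c * x"
instance by standard (simp_all add: scaleC_complex_def algebra_simps)
end

instantiation poly_mapping :: (type, complex_vector) complex_vector
begin

lift_definition scaleC_poly_mapping :: "complex \<Rightarrow> ('a \<Rightarrow>\<^sub>0 'b) \<Rightarrow> ('a \<Rightarrow>\<^sub>0 'b)"
  is "\<lambda>c f k. c *\<^sub>C f k"
  by (auto elim!: rev_finite_subset)

instance
  by (standard; transfer;
      simp add: scaleC_add_right scaleC_add_left scaleC_scaleC scaleC_one)

end

text \<open>
  The tensor product is the free vector space \<open>('a \<times> 'b) \<Rightarrow>\<^sub>0 complex\<close> modulo the subspace generated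
  by the bilinearity relations.
\<close>

definition tensor_relators :: "(('a::complex_vector \<times> 'b::complex_vector) \<Rightarrow>\<^sub>0 complex) set"
  where "tensor_relators =
    {Poly_Mapping.single (a + a', b) 1 - Poly_Mapping.single (a, b) 1 - Poly_Mapping.single (a', b) 1
      | a a' b. True} \<union>
    {Poly_Mapping.single (a, b + b') 1 - Poly_Mapping.single (a, b) 1 - Poly_Mapping.single (a, b') 1
      | a b b'. True} \<union>
    {Poly_Mapping.single (c *\<^sub>C a, b) 1 - c *\<^sub>C Poly_Mapping.single (a, b) 1 | c a b. True} \<union>
    {Poly_Mapping.single (a, c *\<^sub>C b) 1 - c *\<^sub>C Poly_Mapping.single (a, b) 1 | c a b. True}"

definition tensor_rel ::
  "(('a::complex_vector \<times> 'b::complex_vector) \<Rightarrow>\<^sub>0 complex) \<Rightarrow> (('a \<times> 'b) \<Rightarrow>\<^sub>0 complex) \<Rightarrow> bool"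
  where "tensor_rel x y \<longleftrightarrow> x - y \<in> cspan tensor_relators"

lemma tensor_rel_equivp: "equivp tensor_rel"
proof (rule equivpI)
  show "reflp tensor_rel"
    by (simp add: reflp_def tensor_rel_def complex_vector.span_zero)
  show "symp tensor_rel"
    unfolding symp_def tensor_rel_def by (metis complex_vector.span_neg minus_diff_eq)
  show "transp tensor_rel"
    unfolding transp_def tensor_rel_def
    using complex_vector.span_add[of "x - y" _ "y - z" for x y z] by fastforce
qed

quotient_type (overloaded) ('a, 'b) tensor =
  "('a::complex_vector \<times> 'b::complex_vector) \<Rightarrow>\<^sub>0 complex" / tensor_rel
  by (rule tensor_rel_equivp)

instantiation tensor :: (complex_vector, complex_vector) complex_vector
begin

lift_definition zero_tensor :: "('a, 'b) tensor" is 0 .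

lift_definition plus_tensor :: "('a, 'b) tensor \<Rightarrow> ('a, 'b) tensor \<Rightarrow> ('a, 'b) tensor" is "(+)"
  unfolding tensor_rel_def using complex_vector.span_add by (fastforce simp: add_diff_add)

lift_definition uminus_tensor :: "('a, 'b) tensor \<Rightarrow> ('a, 'b) tensor" is uminus
  unfolding tensor_rel_def using complex_vector.span_neg by fastforce

lift_definition minus_tensor :: "('a, 'b) tensor \<Rightarrow> ('a, 'b) tensor \<Rightarrow> ('a, 'b) tensor" is "(-)"
  unfolding tensor_rel_def using complex_vector.span_diff by (fastforce simp: diff_diff_eq2 algebra_simps)

lift_definition scaleC_tensor :: "complex \<Rightarrow> ('a, 'b) tensor \<Rightarrow> ('a, 'b) tensor" is scaleC
  unfolding tensor_rel_def
  by (metis complex_vector.span_scale complex_vector.scale_right_diff_distrib)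

instance
  by standard (transfer; simp add: tensor_rel_def complex_vector.span_zero algebra_simps
      scaleC_add_right scaleC_add_left scaleC_scaleC scaleC_one)+

end

lift_definition tensor_pair :: "'a::complex_vector \<Rightarrow> 'b::complex_vector \<Rightarrow> ('a, 'b) tensor"
    (infixl \<open>\<otimes>\<close> 70)
  is "\<lambda>a b. Poly_Mapping.single (a, b) 1" .

lemma cbilinear_tensor_pair: "cbilinear (\<otimes>)"
  unfolding cbilinear_def
proof (intro conjI allI clinearI)
  have rel: "tensor_rel p q" if "p - q \<in> tensor_relators" for p q :: "('a \<times> 'b) \<Rightarrow>\<^sub>0 complex"
    unfolding tensor_rel_def using that by (rule complex_vector.span_base)
  show "(x + y) \<otimes> b = x \<otimes> b + y \<otimes> b" for x y :: 'a and b :: 'b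
    by transfer (rule rel, unfold tensor_relators_def diff_diff_eq[symmetric], blast)
  show "(c *\<^sub>C x) \<otimes> b = c *\<^sub>C (x \<otimes> b)" for c and x :: 'a and b :: 'b
    by transfer (rule rel, unfold tensor_relators_def diff_diff_eq[symmetric], blast)
  show "a \<otimes> (x + y) = a \<otimes> x + a \<otimes> y" for x y :: 'b and a :: 'a
    by transfer (rule rel, unfold tensor_relators_def diff_diff_eq[symmetric], blast)
  show "a \<otimes> (c *\<^sub>C x) = c *\<^sub>C (a \<otimes> x)" for c and x :: 'b and a :: 'a
    by transfer (rule rel, unfold tensor_relators_def diff_diff_eq[symmetric], blast)
qed

text \<open>
  The linear map induced by a bilinear map \<open>f\<close>. The value does not depend on the representative
  when \<open>f\<close> is bilinear; for other \<open>f\<close> it is unspecified.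
\<close>

definition free_lift :: "('a \<Rightarrow> 'b \<Rightarrow> 'c::complex_vector) \<Rightarrow> (('a \<times> 'b) \<Rightarrow>\<^sub>0 complex) \<Rightarrow> 'c"
  where "free_lift f p = (\<Sum>k\<in>Poly_Mapping.keys p. Poly_Mapping.lookup p k *\<^sub>C f (fst k) (snd k))"

definition tensor_lift ::
  "('a::complex_vector \<Rightarrow> 'b::complex_vector \<Rightarrow> 'c::complex_vector) \<Rightarrow> ('a, 'b) tensor \<Rightarrow> 'c"
  where "tensor_lift f t = free_lift f (rep_tensor t)"

lemma free_lift_superset:
  assumes "finite A" "Poly_Mapping.keys p \<subseteq> A"
  shows "free_lift f p = (\<Sum>k\<in>A. Poly_Mapping.lookup p k *\<^sub>C f (fst k) (snd k))"
  unfolding free_lift_def using assms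
  by (intro sum.mono_neutral_left) (auto simp: in_keys_iff)

lemma clinear_free_lift: "clinear (free_lift f)"
proof (rule clinearI)
  fix p q :: "('a \<times> 'b) \<Rightarrow>\<^sub>0 complex"
  let ?A = "Poly_Mapping.keys p \<union> Poly_Mapping.keys q"
  show "free_lift f (p + q) = free_lift f p + free_lift f q"
    using keys_add[of p q]
    by (simp add: free_lift_superset[of ?A] lookup_add scaleC_add_left sum.distrib)
next
  fix c and p :: "('a \<times> 'b) \<Rightarrow>\<^sub>0 complex"
  have "Poly_Mapping.lookup (c *\<^sub>C p) k = c * Poly_Mapping.lookup p k" for k
    by transfer (simp add: scaleC_complex_def)
  moreover from this have "Poly_Mapping.keys (c *\<^sub>C p) \<subseteq> Poly_Mapping.keys p"
    by (auto simp: in_keys_iff)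
  ultimately show "free_lift f (c *\<^sub>C p) = c *\<^sub>C free_lift f p"
    by (simp add: free_lift_superset[of "Poly_Mapping.keys p"] complex_vector.scale_sum_right
        scaleC_scaleC)
qed

lemma free_lift_single: "free_lift f (Poly_Mapping.single (a, b) 1) = f a b"
  by (simp add: free_lift_def scaleC_one)

lemma free_lift_respects:
  assumes f: "cbilinear f" and "tensor_rel p q"
  shows "free_lift f p = free_lift f q"
proof -
  note [simp] = clinear_diff[OF clinear_free_lift] clinear_scale[OF clinear_free_lift] free_lift_single
  have "free_lift f r = 0" if "r \<in> tensor_relators" for r
    using that f unfolding tensor_relators_def cbilinear_def
    by (auto simp: clinear_add[of "\<lambda>a. f a b" for b] clinear_add[of "f a" for a]
        clinear_scale[of "\<lambda>a. f a b" for b] clinear_scale[of "f a" for a])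
  then have "free_lift f (p - q) = 0"
    using assms(2) clinear_eq_0_on_span[OF clinear_free_lift] unfolding tensor_rel_def by metis
  then show ?thesis by simp
qed

lemma tensor_lift_abs: "cbilinear f \<Longrightarrow> tensor_lift f (abs_tensor p) = free_lift f p"
  unfolding tensor_lift_def
  by (rule free_lift_respects)
    (simp_all add: Quotient3_rep_abs[OF Quotient3_tensor] equivp_reflp[OF tensor_rel_equivp])

lemma tensor_lift_pair: "cbilinear f \<Longrightarrow> tensor_lift f (a \<otimes> b) = f a b"
  by (simp add: tensor_pair.abs_eq tensor_lift_abs free_lift_single)

lemma clinear_tensor_lift:
  assumes "cbilinear f"
  shows "clinear (tensor_lift f)"
proof (rule clinearI)
  show "tensor_lift f (x + y) = tensor_lift f x + tensor_lift f y" for x y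
    by (induct x rule: tensor.abs_induct; induct y rule: tensor.abs_induct)
      (simp add: assms plus_tensor.abs_eq tensor_lift_abs clinear_add[OF clinear_free_lift])
  show "tensor_lift f (c *\<^sub>C x) = c *\<^sub>C tensor_lift f x" for c x
    by (induct x rule: tensor.abs_induct)
      (simp add: assms scaleC_tensor.abs_eq tensor_lift_abs clinear_scale[OF clinear_free_lift])
qed


section \<open>Vertex operator algebras\<close>

text \<open>
  \<open>nprod n a b\<close> is the \<open>n\<close>-th product, so \<open>nprod (n + 1) conf\<close> is the Virasoro operator \<open>L(n)\<close>.
\<close>

definition weight_space :: "(int \<Rightarrow> 'a::complex_vector \<Rightarrow> 'a \<Rightarrow> 'a) \<Rightarrow> 'a \<Rightarrow> nat \<Rightarrow> 'a set"
  where "weight_space nprod conf d = {a. nprod 1 conf a = of_nat d *\<^sub>C a}"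

text \<open>
  The grading is by eigenspaces of \<open>L(0)\<close>, so the sum of the weight spaces is automatically direct.
  By truncation, all sums over \<open>i\<close> in the Borcherds identity have finite support.
\<close>

locale vertex_operator_algebra =
  fixes nprod :: "int \<Rightarrow> 'a::complex_vector \<Rightarrow> 'a \<Rightarrow> 'a"
    and vac :: 'a
    and conf :: 'a
  assumes bilinear: "cbilinear (nprod n)"
    and truncation: "\<exists>N. \<forall>n\<ge>N. nprod n a b = 0"
    and vacuum_left: "nprod n vac a = (if n = -1 then a else 0)"
    and creation: "nprod (-1) a vac = a"
    and creation_regular: "n \<ge> 0 \<Longrightarrow> nprod n a vac = 0"
    and borcherds:
      "Sum_any (\<lambda>i::nat. (of_int p gchoose i) *\<^sub>C nprod (p + q - int i) (nprod (r + int i) a b) c) =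
       Sum_any (\<lambda>i::nat. ((-1) ^ i * (of_int r gchoose i)) *\<^sub>C
         (nprod (p + r - int i) a (nprod (q + int i) b c)
          - ((-1) powi r) *\<^sub>C nprod (q + r - int i) b (nprod (p + int i) a c)))"
    and virasoro: "\<exists>central. \<forall>m n a.
      nprod (m + 1) conf (nprod (n + 1) conf a) - nprod (n + 1) conf (nprod (m + 1) conf a) =
      of_int (m - n) *\<^sub>C nprod (m + n + 1) conf a +
      (if m + n = 0 then (of_int (m ^ 3 - m) / 12 * central) *\<^sub>C a else 0)"
    and translation: "nprod n (nprod 0 conf a) b = - (of_int n *\<^sub>C nprod (n - 1) a b)"
    and grading: "cspan (\<Union>d. weight_space nprod conf d) = UNIV"
    and weight_finite_dim: "\<exists>F. finite F \<and> weight_space nprod conf d = cspan F"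
    and vac_weight: "vac \<in> weight_space nprod conf 0"
    and conf_weight: "conf \<in> weight_space nprod conf 2"

definition CFT_type :: "(int \<Rightarrow> 'a::complex_vector \<Rightarrow> 'a \<Rightarrow> 'a) \<Rightarrow> 'a \<Rightarrow> 'a \<Rightarrow> bool"
  where "CFT_type nprod vac conf \<longleftrightarrow> weight_space nprod conf 0 = cspan {vac}"

definition voa_ideal :: "(int \<Rightarrow> 'a::complex_vector \<Rightarrow> 'a \<Rightarrow> 'a) \<Rightarrow> 'a set \<Rightarrow> bool"
  where "voa_ideal nprod I \<longleftrightarrow>
    csubspace I \<and> (\<forall>n a. \<forall>b\<in>I. nprod n a b \<in> I \<and> nprod n b a \<in> I)"

definition simple_voa :: "(int \<Rightarrow> 'a::complex_vector \<Rightarrow> 'a \<Rightarrow> 'a) \<Rightarrow> bool"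
  where "simple_voa nprod \<longleftrightarrow>
    (UNIV :: 'a set) \<noteq> {0} \<and> (\<forall>I. voa_ideal nprod I \<longrightarrow> I = {0} \<or> I = UNIV)"

text \<open>The list \<open>[(a1, n1), \<dots>, (ar, nr)]\<close> encodes \<open>a1_(-n1) \<dots> ar_(-nr) vac\<close>; the empty list gives \<open>vac\<close>.\<close>

definition strongly_generated :: "(int \<Rightarrow> 'a::complex_vector \<Rightarrow> 'a \<Rightarrow> 'a) \<Rightarrow> 'a \<Rightarrow> 'a set \<Rightarrow> bool"
  where "strongly_generated nprod vac T \<longleftrightarrow>
    cspan {foldr (\<lambda>(a, n) v. nprod (- int n) a v) xs vac | xs. set xs \<subseteq> T \<times> {1..}} = UNIV"

text \<open>
  A vertex operator subalgebra is given by its underlying subspace \<open>W\<close>, with the products of the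
  ambient algebra; the whole algebra is \<open>W = UNIV\<close>.
\<close>

definition C2 :: "(int \<Rightarrow> 'a::complex_vector \<Rightarrow> 'a \<Rightarrow> 'a) \<Rightarrow> 'a set \<Rightarrow> 'a set"
  where "C2 nprod W = cspan {nprod (-2) a b | a b. a \<in> W \<and> b \<in> W}"

definition C2_cofinite :: "(int \<Rightarrow> 'a::complex_vector \<Rightarrow> 'a \<Rightarrow> 'a) \<Rightarrow> 'a set \<Rightarrow> bool"
  where "C2_cofinite nprod W \<longleftrightarrow> quotient_finite_dim (C2 nprod W) (quotient_space W (C2 nprod W))"


section \<open>The tensor square and its fixed points under the swap\<close>

definition tensor_nprod :: "(int \<Rightarrow> 'a::complex_vector \<Rightarrow> 'a \<Rightarrow> 'a) \<Rightarrow>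
    int \<Rightarrow> ('a, 'a) tensor \<Rightarrow> ('a, 'a) tensor \<Rightarrow> ('a, 'a) tensor"
  where "tensor_nprod nprod n x y =
    tensor_lift (\<lambda>a b. tensor_lift
      (\<lambda>u v. Sum_any (\<lambda>i::int. nprod i a u \<otimes> nprod (n - 1 - i) b v)) y) x"

definition tensor_swap :: "('a::complex_vector, 'a) tensor \<Rightarrow> ('a, 'a) tensor"
  where "tensor_swap = tensor_lift (\<lambda>a b. b \<otimes> a)"

definition swap_fixed :: "('a::complex_vector, 'a) tensor set"
  where "swap_fixed = {x. tensor_swap x = x}"

definition eta :: "'a::complex_vector \<Rightarrow> 'a \<Rightarrow> ('a, 'a) tensor"
  where "eta vac a = a \<otimes> vac + vac \<otimes> a"

definition eta_bar :: "(int \<Rightarrow> 'a::complex_vector \<Rightarrow> 'a \<Rightarrow> 'a) \<Rightarrow> 'a \<Rightarrow> 'a \<Rightarrow> ('a, 'a) tensor set"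
  where "eta_bar nprod vac a = eta vac a +o C2 (tensor_nprod nprod) swap_fixed"

text \<open>The defining formula for the products on the tensor square holds on pure tensors.\<close>

lemma (in vertex_operator_algebra) tensor_nprod_pair:
  "tensor_nprod nprod n (a \<otimes> b) (u \<otimes> v) =
    Sum_any (\<lambda>i::int. nprod i a u \<otimes> nprod (n - 1 - i) b v)"
proof -
  define g where "g a b u v = Sum_any (\<lambda>i::int. nprod i a u \<otimes> nprod (n - 1 - i) b v)" for a b u v
  have fin: "finite {i::int. nprod i a u \<otimes> nprod (n - 1 - i) b v \<noteq> 0}" for a b u v
  proof -
    obtain M N where M: "\<And>i. i \<ge> M \<Longrightarrow> nprod i a u = 0" and N: "\<And>i. i \<ge> N \<Longrightarrow> nprod i b v = 0"
      using truncation by meson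
    have "i \<in> {n - 1 - N..M}" if "nprod i a u \<otimes> nprod (n - 1 - i) b v \<noteq> 0" for i
    proof (rule ccontr)
      assume "i \<notin> {n - 1 - N..M}"
      then have "i \<ge> M \<or> n - 1 - i \<ge> N" by auto
      with that M N show False
        using clinear_0[OF conjunct1[OF cbilinear_tensor_pair[unfolded cbilinear_def], rule_format]]
          clinear_0[OF conjunct2[OF cbilinear_tensor_pair[unfolded cbilinear_def], rule_format]]
        by metis
    qed
    then have "{i. nprod i a u \<otimes> nprod (n - 1 - i) b v \<noteq> 0} \<subseteq> {n - 1 - N..M}" by blast
    then show ?thesis by (rule finite_subset) simp
  qed
  have scale: "Sum_any (\<lambda>i. c *\<^sub>C h i) = c *\<^sub>C Sum_any h" if "finite {i. h i \<noteq> 0}"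
    for c and h :: "int \<Rightarrow> ('a, 'a) tensor"
  proof -
    have "Sum_any (\<lambda>i. c *\<^sub>C h i) = (\<Sum>i\<in>{i. h i \<noteq> 0}. c *\<^sub>C h i)"
      by (rule Sum_any.expand_superset) (use that in auto)
    then show ?thesis
      by (simp add: Sum_any.expand_set complex_vector.scale_sum_right)
  qed
  note lin = clinear_add[OF conjunct1[OF cbilinear_tensor_pair[unfolded cbilinear_def], rule_format]]
    clinear_add[OF conjunct2[OF cbilinear_tensor_pair[unfolded cbilinear_def], rule_format]]
    clinear_scale[OF conjunct1[OF cbilinear_tensor_pair[unfolded cbilinear_def], rule_format]]
    clinear_scale[OF conjunct2[OF cbilinear_tensor_pair[unfolded cbilinear_def], rule_format]]
    clinear_add[OF conjunct1[OF bilinear[unfolded cbilinear_def], rule_format]]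
    clinear_add[OF conjunct2[OF bilinear[unfolded cbilinear_def], rule_format]]
    clinear_scale[OF conjunct1[OF bilinear[unfolded cbilinear_def], rule_format]]
    clinear_scale[OF conjunct2[OF bilinear[unfolded cbilinear_def], rule_format]]
  have g_lin: "clinear (\<lambda>a. g a b u v)" "clinear (\<lambda>b. g a b u v)"
    "clinear (\<lambda>u. g a b u v)" "clinear (\<lambda>v. g a b u v)" for a b u v
    by (rule clinearI; simp add: g_def lin Sum_any.distrib[OF fin fin] scale[OF fin])+
  then have g_bl: "cbilinear (g a b)" for a b
    by (simp add: cbilinear_def)
  have "cbilinear (\<lambda>a b. tensor_lift (g a b) y)" for y
  proof (induct y rule: tensor.abs_induct)
    case (1 p)
    show ?case
      unfolding cbilinear_def tensor_lift_abs[OF g_bl] free_lift_def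
      by (intro conjI allI clinearI)
        (simp_all add: clinear_add[OF g_lin(1)] clinear_add[OF g_lin(2)] clinear_scale[OF g_lin(1)]
          clinear_scale[OF g_lin(2)] scaleC_add_right sum.distrib complex_vector.scale_sum_right
          scaleC_scaleC mult.commute)
  qed
  from tensor_lift_pair[OF this, of "u \<otimes> v"] show ?thesis
    unfolding tensor_nprod_def g_def[symmetric] by (simp only: tensor_lift_pair[OF g_bl])
qed

lemma tensor_swap_pair: "tensor_swap (a \<otimes> b) = b \<otimes> a"
  unfolding tensor_swap_def
  by (rule tensor_lift_pair) (use cbilinear_tensor_pair in \<open>auto simp: cbilinear_def\<close>)

lemma clinear_tensor_swap: "clinear tensor_swap"
  unfolding tensor_swap_def
  by (rule clinear_tensor_lift) (use cbilinear_tensor_pair in \<open>auto simp: cbilinear_def\<close>)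

lemma eta_in_swap_fixed: "eta vac a \<in> swap_fixed"
  by (simp add: swap_fixed_def eta_def clinear_add[OF clinear_tensor_swap] tensor_swap_pair add.commute)

end

theory Submission
  imports Defs
begin

text \<open>
  Write \<open>W\<close> for the fixed points of the swap, \<open>U = C2 W\<close> and \<open>R = W / U\<close>. One direction is linear
  algebra: a subspace of a finite-dimensional space is finite-dimensional. For the other one, \<open>R\<close>
  is shown to be a commutative algebra that is generated by finitely many elements, each of which
  is nilpotent up to terms of lower order.

  The product of \<open>R\<close> is the \<open>(-1)\<close>-st one. It is commutative and associative because all correction
  terms of the vertex algebra identities are \<open>n\<close>-th products with \<open>n \<le> -2\<close>, and these lie in \<open>U\<close>
  (\<open>tprod_below_in_fixC2\<close>). The identities are needed only with a first argument \<open>\<eta>(a)\<close>: the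
  \<open>n\<close>-th product by \<open>\<eta>(a)\<close> is the sum of \<open>a_(n)\<close> on either factor, so they reduce to the Borcherds
  identity of \<open>V\<close>; and \<open>W\<close> is spanned by the elements \<open>\<eta>(a)\<close> and \<open>\<eta>(a) \<eta>(b)\<close>, as
  \<open>\<eta>(a) \<eta>(b) = \<eta>(a_(-1) b) + (a \<otimes> b + b \<otimes> a)\<close>.

  The order is measured by the filtration \<open>Fil\<close> of \<open>V\<close>: a monomial in the strong generators has as
  its degree the total weight of its letters, whatever their modes are. All products respect this
  filtration, the products with nonnegative index lower it (\<open>nprod_in_Fil_induct\<close>), and the vectors
  of weight \<open>w\<close> lie in degree \<open>w\<close>. So up to lower degree \<open>V\<close> is a commutative algebra.

  \<^emph>\<open>Generation.\<close> Modulo products of elements of smaller degree, moving \<open>a\<close> from one tensor factor to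
  the other changes the sign, as \<open>\<eta>(a)\<close> times \<open>b \<otimes> c + c \<otimes> b\<close> is such a product. For
  three factors \<open>a, b, c\<close> of positive degree this sign rule is inconsistent unless
  \<open>a \<otimes> b c + b c \<otimes> a\<close>, and hence \<open>\<eta>(a b c)\<close>, is generated by elements of smaller degree
  (\<open>eta_triple_product_in_etaFil\<close>); this is the fact that power sums in two variables are
  polynomials in the first two of them. Only the images \<open>\<eta>(x)\<close> and \<open>\<eta>(x_(-n) y)\<close> of words with at
  most two letters remain, because \<open>L(-1)\<close> maps into \<open>U\<close> and moves all derivatives to one letter.
  By hypothesis finitely many of these suffice, for each pair \<open>x, y\<close> separately, so that the degree
  stays under control.

  \<^emph>\<open>Nilpotency.\<close> As \<open>V\<close> is \<open>C2\<close>-cofinite, vectors of large weight \<open>w\<close> are sums of products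
  \<open>u_(-2) v\<close>, where the weights of \<open>u\<close> and \<open>v\<close> add up to \<open>w - 1\<close>; hence they have degree at most
  \<open>w - 1\<close>. So a high power of a generator \<open>x\<close> has less than the expected degree, and the same holds
  for \<open>x_(-n) y\<close>. The power \<open>\<eta>(a)^(2 k)\<close> is a combination of tensors of \<open>a^i\<close> and \<open>a^j\<close> with
  \<open>i + j = 2 k\<close>, one of which is at least the \<open>k\<close>-th power, so \<open>\<eta>(a)^(2 k)\<close> has less than the
  expected degree. By induction on the degree, \<open>R\<close> is spanned by the products of bounded length
  (\<open>etaFil_finite_modulo_C2\<close>).
\<close>

section \<open>Finite-dimensional quotients\<close>

text \<open>
  Exchange the elements of \<open>F\<close> one by one for elements of \<open>A\<close>. Moving the exchanged elements into
  \<open>U\<close> keeps the induction going, hence the arbitrary set \<open>U\<close>.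
\<close>

lemma finite_spanning_subset_modulo:
  assumes "finite F" "A \<subseteq> cspan (U \<union> F)"
  shows "\<exists>A'. finite A' \<and> A' \<subseteq> A \<and> A \<subseteq> cspan (U \<union> A')"
  using assms
proof (induction F arbitrary: U)
  case empty
  then show ?case by (intro exI[of _ "{}"]) auto
next
  case (insert f F)
  show ?case
  proof (cases "A \<subseteq> cspan (U \<union> F)")
    case True
    then show ?thesis using insert.IH by blast
  next
    case False
    then obtain a where a: "a \<in> A" "a \<notin> cspan (U \<union> F)" by blast
    with insert.prems have "a \<in> cspan (insert f (U \<union> F))" by auto
    with a have f: "f \<in> cspan (insert a (U \<union> F))"
      using complex_vector.in_span_insert by blast
    have "U \<union> insert f F \<subseteq> cspan (insert a U \<union> F)"
      using f complex_vector.span_superset[of "insert a U \<union> F"] by auto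
    then have "cspan (U \<union> insert f F) \<subseteq> cspan (insert a U \<union> F)"
      by (rule complex_vector.span_minimal) simp
    with insert.prems insert.IH[of "insert a U"] obtain A'
      where "finite A'" "A' \<subseteq> A" "A \<subseteq> cspan (insert a U \<union> A')" by blast
    with a(1) show ?thesis by (intro exI[of _ "insert a A'"]) simp
  qed
qed

text \<open>
  Translates finite dimensionality in terms of cosets into a statement about spans of vectors, which is
  the form used in all that follows.
\<close>

lemma quotient_finite_dim_span_iff:
  assumes U: "csubspace U"
  shows "quotient_finite_dim U (quotient_span U ((\<lambda>a. a +o U) ` A)) \<longleftrightarrow>
    (\<exists>F. finite F \<and> A \<subseteq> cspan (U \<union> F))"
proof
  assume "quotient_finite_dim U (quotient_span U ((\<lambda>a. a +o U) ` A))"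
  then obtain F where F: "finite F" "F \<subseteq> (\<lambda>a. a +o U) ` cspan A"
    and eq: "quotient_span U F = (\<lambda>a. a +o U) ` cspan A"
    unfolding quotient_finite_dim_def quotient_span_cosets[OF U] by blast
  then obtain F0 where F0: "finite F0" "F = (\<lambda>a. a +o U) ` F0"
    by (meson finite_subset_image)
  have "a \<in> cspan (U \<union> F0)" if "a \<in> A" for a
  proof -
    have "a +o U \<in> quotient_span U F"
      unfolding eq using that by (blast intro: complex_vector.span_base)
    then obtain b where b: "b \<in> cspan F0" "a +o U = b +o U"
      unfolding F0 quotient_span_cosets[OF U] by blast
    have "a \<in> a +o U"
      using complex_vector.subspace_0[OF U] by (force simp: elt_set_plus_def)
    with b(2) obtain u where "u \<in> U" "a = b + u"
      by (auto simp: elt_set_plus_def)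
    with b(1) show ?thesis
      using complex_vector.span_mono[of F0 "U \<union> F0"]
      by (auto intro!: complex_vector.span_add intro: complex_vector.span_base)
  qed
  with F0(1) show "\<exists>F. finite F \<and> A \<subseteq> cspan (U \<union> F)" by blast
next
  assume "\<exists>F. finite F \<and> A \<subseteq> cspan (U \<union> F)"
  then obtain A' where A': "finite A'" "A' \<subseteq> A" "A \<subseteq> cspan (U \<union> A')"
    using finite_spanning_subset_modulo by metis
  have "a +o U \<in> (\<lambda>a. a +o U) ` cspan A'" if "a \<in> cspan A" for a
  proof -
    have "a \<in> cspan (U \<union> A')"
      using that complex_vector.span_minimal[OF A'(3)] by auto
    then obtain u b where ub: "u \<in> U" "b \<in> cspan A'" "a = u + b"
      unfolding complex_vector.span_Un complex_vector.span_eq_iff[THEN iffD2, OF U] by blast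
    have "u +o U = U"
    proof
      show "u +o U \<subseteq> U"
        using ub(1) U complex_vector.subspace_add by (auto simp: elt_set_plus_def)
      show "U \<subseteq> u +o U"
      proof
        fix x assume "x \<in> U"
        then have "x - u \<in> U" "x = u + (x - u)"
          using ub(1) U complex_vector.subspace_diff by auto
        then show "x \<in> u +o U" unfolding elt_set_plus_def by blast
      qed
    qed
    moreover have "0 +o U = U"
      by (simp add: elt_set_plus_def)
    ultimately have "a +o U = b +o U"
      using coset_add[OF U, of u b] coset_add[OF U, of 0 b] ub(3) by simp
    with ub(2) show ?thesis by blast
  qed
  then have "(\<lambda>a. a +o U) ` cspan A = (\<lambda>a. a +o U) ` cspan A'"
    using complex_vector.span_mono[OF A'(2)] by blast
  then show "quotient_finite_dim U (quotient_span U ((\<lambda>a. a +o U) ` A))"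
    unfolding quotient_finite_dim_def
    using A'(1,2) by (intro exI[of _ "(\<lambda>a. a +o U) ` A'"])
      (auto simp: quotient_span_cosets[OF U] intro: complex_vector.span_base)
qed

lemma csubspace_C2: "csubspace (C2 f W)"
  by (simp add: C2_def)

lemma C2_cofinite_iff:
  assumes "csubspace W"
  shows "C2_cofinite f W \<longleftrightarrow> (\<exists>F. finite F \<and> W \<subseteq> cspan (C2 f W \<union> F))"
proof -
  have "quotient_space W (C2 f W) = quotient_span (C2 f W) ((\<lambda>a. a +o C2 f W) ` W)"
    using assms by (simp add: quotient_span_cosets[OF csubspace_C2] quotient_space_def
        complex_vector.span_eq_iff[THEN iffD2])
  then show ?thesis
    by (simp add: C2_cofinite_def quotient_finite_dim_span_iff[OF csubspace_C2])
qed

text \<open>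
  Applying \<open>L - j\<close> kills one summand and rescales the others by nonzero factors.
\<close>

lemma eigenvectors_sum_eq_0:
  assumes L: "clinear L" and "finite I"
    and "\<And>i. i \<in> I \<Longrightarrow> L (f i) = of_int i *\<^sub>C f i"
    and "sum f I = 0" "i \<in> I"
  shows "f i = 0"
  using assms(2-)
proof (induction I arbitrary: f i)
  case empty
  then show ?case by simp
next
  case (insert j I)
  let ?g = "\<lambda>i. of_int (i - j) *\<^sub>C f i"
  have sumL: "L (sum f I) = (\<Sum>i\<in>I. L (f i))"
    using insert.hyps(1) by (induction) (simp_all add: clinear_0[OF L] clinear_add[OF L])
  have fj: "f j = - sum f I"
    using insert.prems insert.hyps by (simp add: eq_neg_iff_add_eq_0)
  have "sum ?g I = L (sum f I) - of_int j *\<^sub>C sum f I"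
    unfolding sumL complex_vector.scale_sum_right sum_subtractf[symmetric]
    by (rule sum.cong)
      (simp_all add: insert.prems complex_vector.scale_left_diff_distrib)
  also have "\<dots> = - (L (f j) - of_int j *\<^sub>C f j)"
    unfolding fj using clinear_diff[OF L, of 0 "sum f I"] by (simp add: clinear_0[OF L])
  also have "\<dots> = 0"
    using insert.prems by simp
  finally have s: "sum ?g I = 0" .
  have e: "L (?g k) = of_int k *\<^sub>C ?g k" if "k \<in> I" for k
    using that insert.prems(1)[of k]
    by (simp add: clinear_scale[OF L] scaleC_scaleC mult.commute)
  have z: "f k = 0" if "k \<in> I" for k
  proof -
    have "?g k = 0"
      by (rule insert.IH[of ?g, OF e s that])
    moreover have "k \<noteq> j" using that insert.hyps by blast
    ultimately show ?thesis by simp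
  qed
  then have "sum f I = 0" by simp
  with fj have "f j = 0" by simp
  with z insert.prems(3) show ?case by auto
qed

text \<open>
  This replaces the projection to a weight space: sorting the summands of \<open>v\<close> by eigenvalue, all parts
  with an eigenvalue other than \<open>w\<close> cancel.
\<close>

lemma eigenvector_in_span_of_own_weight:
  assumes L: "clinear L" and S: "\<And>i s. s \<in> S i \<Longrightarrow> L s = of_int i *\<^sub>C s"
    and v: "v \<in> cspan (\<Union>i. S i)" and w: "L v = of_int w *\<^sub>C v"
  shows "v \<in> cspan (S w)"
proof -
  have Lspan: "L s = of_int i *\<^sub>C s" if "s \<in> cspan (S i)" for s i
    using that by (induction rule: complex_vector.span_induct_alt)
      (simp_all add: clinear_0[OF L] clinear_add[OF L] clinear_scale[OF L] S
        scaleC_add_right scaleC_scaleC mult.commute)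
  have "\<exists>f I. finite I \<and> (\<forall>i. f i \<in> cspan (S i)) \<and> v = sum f I"
    using v
  proof (induction rule: complex_vector.span_induct_alt)
    case base
    show ?case
      by (intro exI[of _ "\<lambda>_. 0"] exI[of _ "{}"]) (simp add: complex_vector.span_zero)
  next
    case (step c x y)
    then obtain f I j where f: "finite I" "\<And>i. f i \<in> cspan (S i)" "y = sum f I" "x \<in> S j"
      by blast
    define f' where "f' i = (if i \<in> I then f i else 0) + (if i = j then c *\<^sub>C x else 0)" for i
    have "f' i \<in> cspan (S i)" for i
      using f(2,4) by (auto simp: f'_def intro: complex_vector.span_add complex_vector.span_scale
          complex_vector.span_base complex_vector.span_zero)
    moreover have "sum f' (insert j I) = y + c *\<^sub>C x"
    proof -
      have "(\<Sum>i\<in>insert j I. if i \<in> I then f i else 0) = sum f I"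
        using f(1) by (intro sum.mono_neutral_cong_right) auto
      then show ?thesis
        using f(1,3) unfolding f'_def sum.distrib by simp
    qed
    ultimately show ?case
      using f(1) by (intro exI[of _ f'] exI[of _ "insert j I"]) (simp add: add.commute)
  qed
  then obtain f I where f: "finite I" "\<And>i. f i \<in> cspan (S i)" "v = sum f I" by blast
  define g where "g i = of_int (i - w) *\<^sub>C f i" for i
  have sumL: "L (sum f I) = (\<Sum>i\<in>I. L (f i))"
    using f(1) by (induction) (simp_all add: clinear_0[OF L] clinear_add[OF L])
  have "sum g I = L v - of_int w *\<^sub>C v"
    unfolding f(3) sumL complex_vector.scale_sum_right sum_subtractf[symmetric] g_def
    by (rule sum.cong)
      (simp_all add: Lspan[OF f(2)] complex_vector.scale_left_diff_distrib)
  with w have s: "sum g I = 0" by simp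
  have e: "L (g k) = of_int k *\<^sub>C g k" for k
    by (simp add: g_def clinear_scale[OF L] Lspan[OF f(2)] scaleC_scaleC mult.commute)
  have z: "f k = 0" if "k \<in> I" "k \<noteq> w" for k
    using eigenvectors_sum_eq_0[of L I g k, OF L f(1) e s that(1)] that(2) by (simp add: g_def)
  have "sum f I = (if w \<in> I then f w else 0)"
  proof (cases "w \<in> I")
    case True
    then have "sum f I = sum f {w}"
      using f(1) z by (intro sum.mono_neutral_right) auto
    with True show ?thesis by simp
  next
    case False
    with z have "\<forall>k\<in>I. f k = 0" by blast
    with False show ?thesis by simp
  qed
  then show ?thesis
    using f(2,3) by (auto simp: complex_vector.span_zero)
qed

text \<open>
  This holds for any family, as a sum with infinite support is \<open>0\<close> by definition.
\<close>

lemma Sum_any_in_subspace: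
  assumes "csubspace S" "\<And>i. f i \<in> S"
  shows "Sum_any f \<in> S"
  unfolding Sum_any.expand_set using assms by (intro complex_vector.subspace_sum) auto

section \<open>The filtration by generator weight\<close>

lemma Sum_any_eq_single:
  assumes "\<And>i. i \<noteq> j \<Longrightarrow> f i = 0"
  shows "Sum_any f = f j"
  using Sum_any.expand_superset[of "{j}" f] assms by auto

context vertex_operator_algebra
begin

lemma clinear_nprod: "clinear (nprod n a)"
  and clinear_nprod_left: "clinear (\<lambda>a. nprod n a b)"
  using bilinear unfolding cbilinear_def by blast+

lemmas nprod_linear =
  clinear_add[OF clinear_nprod] clinear_add[OF clinear_nprod_left]
  clinear_diff[OF clinear_nprod] clinear_diff[OF clinear_nprod_left]
  clinear_scale[OF clinear_nprod] clinear_scale[OF clinear_nprod_left]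
  clinear_0[OF clinear_nprod] clinear_0[OF clinear_nprod_left]

text \<open>
  The Borcherds identity with \<open>r = 0\<close>, and below with \<open>p = 0\<close>: one side collapses to a single term.
\<close>

lemma commutator_formula:
  "nprod p a (nprod q b c) - nprod q b (nprod p a c) =
    Sum_any (\<lambda>i::nat. (of_int p gchoose i) *\<^sub>C nprod (p + q - int i) (nprod (int i) a b) c)"
proof -
  have 0: "((0::complex) gchoose i) = 0" if "i \<noteq> 0" for i
    using that by (cases i) simp_all
  show ?thesis
    using borcherds[of p q 0 a b c] Sum_any_eq_single[where j = "0::nat" and
        f = "\<lambda>i. ((-1) ^ i * (of_int 0 gchoose i)) *\<^sub>C
         (nprod (p + 0 - int i) a (nprod (q + int i) b c)
          - ((-1) powi 0) *\<^sub>C nprod (q + 0 - int i) b (nprod (p + int i) a c))"]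
    by (simp add: 0 scaleC_one)
qed

lemma associativity_formula:
  "nprod q (nprod r a b) c =
    Sum_any (\<lambda>i::nat. ((-1) ^ i * (of_int r gchoose i)) *\<^sub>C
         (nprod (r - int i) a (nprod (q + int i) b c)
          - ((-1) powi r) *\<^sub>C nprod (q + r - int i) b (nprod (int i) a c)))"
proof -
  have 0: "((0::complex) gchoose i) = 0" if "i \<noteq> 0" for i
    using that by (cases i) simp_all
  show ?thesis
    using borcherds[of 0 q r a b c] Sum_any_eq_single[where j = "0::nat" and
        f = "\<lambda>i. (of_int 0 gchoose i) *\<^sub>C nprod (0 + q - int i) (nprod (r + int i) a b) c"]
    by (simp add: 0 scaleC_one)
qed

text \<open>
  Weights are integers here, so that the weight of a product needs no case distinction; the spaces of
  negative weight turn out to be zero.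
\<close>

definition wspace :: "int \<Rightarrow> 'a set"
  where "wspace k = {a. nprod 1 conf a = of_int k *\<^sub>C a}"

lemma weight_space_eq_wspace: "weight_space nprod conf d = wspace (int d)"
  by (simp add: weight_space_def wspace_def)

lemma nprod_wspace:
  assumes "a \<in> wspace p" "b \<in> wspace q"
  shows "nprod n a b \<in> wspace (p + q - n - 1)"
proof -
  let ?f = "\<lambda>i::nat. (of_int 1 gchoose i :: complex) *\<^sub>C nprod (1 + n - int i) (nprod (int i) conf a) b"
  have "?f i = 0" if "i \<notin> {0, 1}" for i
  proof -
    have "(1 gchoose i :: complex) = of_nat (1 choose i)"
      using binomial_gbinomial[of 1 i, where 'a = complex] by simp
    moreover have "1 choose i = 0" using that by (intro binomial_eq_0) auto
    ultimately show ?thesis by simp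
  qed
  then have "Sum_any ?f = sum ?f {0, 1}"
    by (intro Sum_any.expand_superset) auto
  also have "\<dots> = nprod (n + 1) (nprod 0 conf a) b + nprod n (nprod 1 conf a) b"
    by (simp add: scaleC_one add.commute)
  also have "\<dots> = of_int (p - n - 1) *\<^sub>C nprod n a b"
    using assms by (simp add: translation wspace_def nprod_linear
        complex_vector.scale_left_diff_distrib scaleC_add_left)
  finally have "nprod 1 conf (nprod n a b) - nprod n a (nprod 1 conf b)
      = of_int (p - n - 1) *\<^sub>C nprod n a b"
    by (simp add: commutator_formula)
  with assms(2) show ?thesis
    by (simp add: wspace_def nprod_linear complex_vector.scale_left_diff_distrib scaleC_add_left
        algebra_simps)
qed

lemma vac_wspace: "vac \<in> wspace 0"
  using vac_weight by (simp add: weight_space_eq_wspace)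

end

locale strongly_generated_voa = vertex_operator_algebra nprod vac conf
  for nprod :: "int \<Rightarrow> 'a::complex_vector \<Rightarrow> 'a \<Rightarrow> 'a" and vac conf :: 'a +
  fixes T :: "'a set" and wt :: "'a \<Rightarrow> nat"
  assumes wt_pos: "x \<in> T \<Longrightarrow> wt x \<ge> 1"
    and homogeneous: "x \<in> T \<Longrightarrow> x \<in> weight_space nprod conf (wt x)"
    and generated: "strongly_generated nprod vac T"
begin

definition monomial :: "('a \<times> nat) list \<Rightarrow> 'a"
  where "monomial xs = foldr (\<lambda>(a, n) v. nprod (- int n) a v) xs vac"

definition degree :: "('a \<times> nat) list \<Rightarrow> nat"
  where "degree xs = (\<Sum>(x, n)\<leftarrow>xs. wt x)"

text \<open>
  Known as the standard filtration. Indices are integers, so that \<open>Fil (-1) = {0}\<close> and the statement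
  that a degree drops by one remains meaningful in degree \<open>0\<close>.
\<close>

definition Fil :: "int \<Rightarrow> 'a set"
  where "Fil k = cspan {monomial xs | xs. set xs \<subseteq> T \<times> {1..} \<and> int (degree xs) \<le> k}"

lemma monomial_simps [simp]:
  "monomial [] = vac" "monomial ((x, n) # xs) = nprod (- int n) x (monomial xs)"
  by (simp_all add: monomial_def)

lemma degree_simps [simp]: "degree [] = 0" "degree ((x, n) # xs) = wt x + degree xs"
  by (simp_all add: degree_def)

lemma csubspace_Fil [simp]: "csubspace (Fil k)"
  by (simp add: Fil_def)

lemmas Fil_add = complex_vector.subspace_add[OF csubspace_Fil]
  and Fil_diff = complex_vector.subspace_diff[OF csubspace_Fil]
  and Fil_scale = complex_vector.subspace_scale[OF csubspace_Fil]
  and Fil_0 = complex_vector.subspace_0[OF csubspace_Fil]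

lemma monomial_in_Fil: "set xs \<subseteq> T \<times> {1..} \<Longrightarrow> int (degree xs) \<le> k \<Longrightarrow> monomial xs \<in> Fil k"
  unfolding Fil_def by (rule complex_vector.span_base) blast

lemma Fil_mono: "k \<le> l \<Longrightarrow> Fil k \<subseteq> Fil l"
  unfolding Fil_def by (rule complex_vector.span_mono) auto

lemma Fil_negative: "k < 0 \<Longrightarrow> Fil k = {0}"
  by (simp add: Fil_def)

lemma vac_in_Fil: "k \<ge> 0 \<Longrightarrow> vac \<in> Fil k"
  using monomial_in_Fil[of "[]" k] by simp

lemma Fil_induct [consumes 1, case_names zero step]:
  assumes "a \<in> Fil k" and "P 0"
    and "\<And>c xs b. set xs \<subseteq> T \<times> {1..} \<Longrightarrow> int (degree xs) \<le> k \<Longrightarrow> b \<in> Fil k \<Longrightarrow> P b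
      \<Longrightarrow> P (c *\<^sub>C monomial xs + b)"
  shows "P a"
proof -
  have "a \<in> Fil k \<and> P a"
    using assms(1) unfolding Fil_def
  proof (induction rule: complex_vector.span_induct_alt)
    case base
    show ?case using assms(2) by (simp add: complex_vector.span_zero)
  next
    case (step c x y)
    then show ?case
      using assms(3)[of _ y c] unfolding Fil_def
      by (auto intro: complex_vector.span_add complex_vector.span_scale complex_vector.span_base)
  qed
  then show ?thesis ..
qed

lemma generator_nprod_in_Fil:
  assumes "x \<in> T" "n < 0" "b \<in> Fil q"
  shows "nprod n x b \<in> Fil (int (wt x) + q)"
  using assms(3)
proof (induction rule: Fil_induct)
  case zero
  show ?case by (simp add: nprod_linear Fil_0)
next
  case (step c xs b)
  have "monomial ((x, nat (- n)) # xs) \<in> Fil (int (wt x) + q)"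
    using assms step by (intro monomial_in_Fil) auto
  then show ?case
    using step assms(2) by (simp add: nprod_linear Fil_add Fil_scale)
qed

lemma generator_in_Fil:
  assumes "x \<in> T" shows "x \<in> Fil (int (wt x))"
  using generator_nprod_in_Fil[OF assms, of "-1" vac 0] by (simp add: creation vac_in_Fil)

lemma monomial_wspace:
  assumes "set xs \<subseteq> T \<times> {1..}"
  shows "\<exists>k\<ge>int (degree xs). monomial xs \<in> wspace k"
  using assms
proof (induction xs)
  case Nil
  show ?case using vac_wspace by auto
next
  case (Cons g xs)
  obtain x n where g: "g = (x, n)" "x \<in> T" "n \<ge> 1"
    using Cons.prems by (cases g) auto
  from Cons obtain k where k: "k \<ge> int (degree xs)" "monomial xs \<in> wspace k" by auto
  have "monomial (g # xs) \<in> wspace (int (wt x) + k - (- int n) - 1)"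
    unfolding g monomial_simps using g(2) homogeneous k(2)
    by (intro nprod_wspace) (auto simp: weight_space_eq_wspace)
  moreover have "int (degree (g # xs)) \<le> int (wt x) + k - (- int n) - 1"
    using g k(1) by simp
  ultimately show ?case by blast
qed

text \<open>
  A monomial has a weight at least equal to its degree, since each mode \<open>n \<ge> 1\<close> adds \<open>n - 1\<close> to the
  weight; and a homogeneous vector is a combination of monomials of its own weight.
\<close>

lemma wspace_subset_Fil: "wspace w \<subseteq> Fil w"
proof
  fix v assume v: "v \<in> wspace w"
  let ?S = "\<lambda>i. {monomial xs | xs. set xs \<subseteq> T \<times> {1..} \<and> int (degree xs) \<le> i \<and> monomial xs \<in> wspace i}"
  have "{monomial xs | xs. set xs \<subseteq> T \<times> {1..}} \<subseteq> (\<Union>i. ?S i)"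
    using monomial_wspace by blast
  moreover have "cspan {monomial xs | xs. set xs \<subseteq> T \<times> {1..}} = UNIV"
    using generated by (simp add: strongly_generated_def monomial_def)
  ultimately have "v \<in> cspan (\<Union>i. ?S i)"
    using complex_vector.span_mono by blast
  then have "v \<in> cspan (?S w)"
    by (rule eigenvector_in_span_of_own_weight[OF clinear_nprod[of 1 conf], rotated])
      (use v in \<open>auto simp: wspace_def\<close>)
  moreover have "cspan (?S w) \<subseteq> Fil w"
    unfolding Fil_def by (rule complex_vector.span_mono) auto
  ultimately show "v \<in> Fil w" ..
qed

lemma generator_nprod_generator_in_Fil:
  assumes "x \<in> T" "y \<in> T" "n \<ge> 0"
  shows "nprod n x y \<in> Fil (int (wt x) + int (wt y) - 1)"
proof -
  have "nprod n x y \<in> wspace (int (wt x) + int (wt y) - n - 1)"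
    using assms homogeneous by (intro nprod_wspace) (auto simp: weight_space_eq_wspace)
  then show ?thesis
    using wspace_subset_Fil assms(3)
      Fil_mono[of "int (wt x) + int (wt y) - n - 1" "int (wt x) + int (wt y) - 1"] by auto
qed

text \<open>
  The two claims are proved together by induction on \<open>p + q\<close>. The associativity formula removes the
  first letter \<open>x\<close> of \<open>a\<close>; this leaves either negative modes of \<open>x\<close>, which only prepend a letter, or
  terms with \<open>x_(j) b\<close> for \<open>j \<ge> 0\<close>. The latter lose a degree: the commutator formula moves \<open>x_(j)\<close>
  through \<open>b\<close>, and for a letter \<open>y\<close> of \<open>b\<close> the vector \<open>x_(i) y\<close> has a weight, hence a degree,
  below the sum of the weights.
\<close>

lemma nprod_in_Fil_induct:
  assumes "p + q < int m" "a \<in> Fil p" "b \<in> Fil q"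
  shows "nprod n a b \<in> Fil (p + q) \<and> (n \<ge> 0 \<longrightarrow> nprod n a b \<in> Fil (p + q - 1))"
  using assms
proof (induction m arbitrary: p q a b n)
  case 0
  then have "a = 0 \<or> b = 0" using Fil_negative[of p] Fil_negative[of q] by fastforce
  then show ?case by (auto simp: nprod_linear Fil_0)
next
  case (Suc m)
  have IH: "nprod n a b \<in> Fil (p + q)" "n \<ge> 0 \<Longrightarrow> nprod n a b \<in> Fil (p + q - 1)"
    if "p + q < int m" "a \<in> Fil p" "b \<in> Fil q" for p q a b n
    using Suc.IH that by blast+
  \<comment> \<open>nonnegative modes of a generator lower the degree\<close>
  have gen: "nprod j x b \<in> Fil (int (wt x) + q - 1)"
    if x: "x \<in> T" and j: "j \<ge> 0" and m: "int (wt x) + q \<le> int m" and b: "b \<in> Fil q" for x j b q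
    using b
  proof (induction rule: Fil_induct)
    case zero
    show ?case by (simp add: nprod_linear Fil_0)
  next
    case (step c ys b)
    have "nprod j x (monomial ys) \<in> Fil (int (wt x) + q - 1)"
    proof (cases ys)
      case Nil
      with j show ?thesis by (simp add: creation_regular Fil_0)
    next
      case (Cons g zs)
      then obtain y k where g: "ys = (y, k) # zs" "y \<in> T" "k \<ge> 1" "set zs \<subseteq> T \<times> {1..}"
        using step by (cases g) auto
      define r where "r = q - int (wt y)"
      have z: "monomial zs \<in> Fil r"
        using g step by (intro monomial_in_Fil) (auto simp: r_def)
      have "nprod j x (monomial zs) \<in> Fil (int (wt x) + r - 1)"
        using IH(2)[OF _ generator_in_Fil[OF x] z j] m wt_pos[OF g(2)] by (simp add: r_def)
      from generator_nprod_in_Fil[OF g(2) _ this, of "- int k"] g(3)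
      have 1: "nprod (- int k) y (nprod j x (monomial zs)) \<in> Fil (int (wt x) + q - 1)"
        by (simp add: r_def algebra_simps)
      have "nprod l (nprod (int i) x y) (monomial zs) \<in> Fil (int (wt x) + q - 1)" for l i
        using IH(1)[OF _ generator_nprod_generator_in_Fil[OF x g(2), of "int i"] z, of l] m
        by (simp add: r_def algebra_simps)
      then have 2: "Sum_any (\<lambda>i::nat. (of_int j gchoose i) *\<^sub>C
          nprod (j + (- int k) - int i) (nprod (int i) x y) (monomial zs)) \<in> Fil (int (wt x) + q - 1)"
        by (intro Sum_any_in_subspace csubspace_Fil Fil_scale)
      show ?thesis
        using Fil_add[OF 1 2] unfolding commutator_formula[symmetric] g(1) by simp
    qed
    with step show ?case by (simp add: nprod_linear Fil_add Fil_scale)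
  qed
  from Suc.prems(2) show ?case
  proof (induction rule: Fil_induct)
    case zero
    show ?case by (simp add: nprod_linear Fil_0)
  next
    case (step c xs a)
    have "nprod n (monomial xs) b \<in> Fil (p + q) \<and>
        (n \<ge> 0 \<longrightarrow> nprod n (monomial xs) b \<in> Fil (p + q - 1))"
    proof (cases xs)
      case Nil
      then show ?thesis
        using Suc.prems(3) step(2) Fil_mono[of q "p + q"]
        by (auto simp: vacuum_left Fil_0)
    next
      case (Cons g zs)
      then obtain x k where g: "xs = (x, k) # zs" "x \<in> T" "k \<ge> 1" "set zs \<subseteq> T \<times> {1..}"
        using step by (cases g) auto
      define d where "d = int (wt x)"
      have d: "d \<ge> 1" using wt_pos[OF g(2)] by (simp add: d_def)
      have z: "monomial zs \<in> Fil (p - d)"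
        using g step by (intro monomial_in_Fil) (auto simp: d_def)
      have pd: "p \<ge> d" using g step by (simp add: d_def)
      have first: "nprod (- int k - int i) x (nprod (n + int i) (monomial zs) b) \<in> Fil (p + q)"
        "n \<ge> 0 \<Longrightarrow> nprod (- int k - int i) x (nprod (n + int i) (monomial zs) b) \<in> Fil (p + q - 1)"
        for i
      proof -
        have m: "p - d + q < int m" using Suc.prems(1) d by simp
        show "nprod (- int k - int i) x (nprod (n + int i) (monomial zs) b) \<in> Fil (p + q)"
          using generator_nprod_in_Fil[OF g(2) _ IH(1)[OF m z Suc.prems(3)], of "- int k - int i" "n + int i"] g(3)
          by (simp add: d_def)
        show "nprod (- int k - int i) x (nprod (n + int i) (monomial zs) b) \<in> Fil (p + q - 1)"
          if "n \<ge> 0"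
          using generator_nprod_in_Fil[OF g(2) _ IH(2)[OF m z Suc.prems(3)], of "- int k - int i" "n + int i"] g(3) that
          by (simp add: d_def algebra_simps)
      qed
      have second: "nprod l (monomial zs) (nprod (int i) x b) \<in> Fil (p + q - 1)" for l i
      proof -
        have "nprod (int i) x b \<in> Fil (d + q - 1)"
          unfolding d_def by (rule gen) (use g Suc.prems pd in \<open>auto simp: d_def\<close>)
        from IH(1)[OF _ z this, of l] Suc.prems(1) show ?thesis by (simp add: algebra_simps)
      qed
      have second': "nprod l (monomial zs) (nprod (int i) x b) \<in> Fil (p + q)" for l i
        using second Fil_mono[of "p + q - 1" "p + q"] by auto
      show ?thesis
        unfolding g(1) monomial_simps associativity_formula
        by (intro conjI impI Sum_any_in_subspace csubspace_Fil Fil_scale Fil_diff first second second')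
    qed
    with step show ?case by (simp add: nprod_linear Fil_add Fil_scale)
  qed
qed

lemma nprod_in_Fil:
  assumes "a \<in> Fil p" "b \<in> Fil q" "p + q \<le> k"
  shows "nprod n a b \<in> Fil k"
  using nprod_in_Fil_induct[of p q "nat (p + q + 1)" a b n] assms Fil_mono[of "p + q" k]
  by auto

lemma nprod_nonneg_in_Fil:
  assumes "a \<in> Fil p" "b \<in> Fil q" "n \<ge> 0" "p + q \<le> k + 1"
  shows "nprod n a b \<in> Fil k"
  using nprod_in_Fil_induct[of p q "nat (p + q + 1)" a b n] assms Fil_mono[of "p + q - 1" k]
  by auto

end

section \<open>Powers up to lower degree\<close>

context vertex_operator_algebra
begin

lemma finite_associativity_support:
  "finite {i::nat. s i *\<^sub>C (nprod (r - int i) a (nprod (q + int i) b c)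
      - e *\<^sub>C nprod (q + r - int i) b (nprod (int i) a c)) \<noteq> 0}"
proof -
  obtain M N where M: "\<And>n. n \<ge> M \<Longrightarrow> nprod n b c = 0" and N: "\<And>n. n \<ge> N \<Longrightarrow> nprod n a c = 0"
    using truncation by meson
  have "i < nat (max (M - q) N)" if "s i *\<^sub>C (nprod (r - int i) a (nprod (q + int i) b c)
      - e *\<^sub>C nprod (q + r - int i) b (nprod (int i) a c)) \<noteq> 0" for i
  proof (rule ccontr)
    assume "\<not> i < nat (max (M - q) N)"
    then have "q + int i \<ge> M" "int i \<ge> N" by linarith+
    with that show False by (simp add: M N nprod_linear)
  qed
  then show ?thesis
    by (intro finite_subset[OF _ finite_lessThan[of "nat (max (M - q) N)"]]) blast
qed

text \<open>
  Modes \<open>x_(-n)\<close> can thus be treated as \<open>(-1)\<close>-st products.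
\<close>

lemma nprod_creation_field:
  assumes "n \<ge> 1"
  shows "nprod (-1) (nprod (- n) x vac) y = nprod (- n) x y"
proof -
  have "nprod (-1) (nprod (- n) x vac) y = ((-1) ^ 0 * (of_int (- n) gchoose 0)) *\<^sub>C
         (nprod (- n - int 0) x (nprod (- 1 + int 0) vac y)
          - ((-1) powi (- n)) *\<^sub>C nprod (- 1 + (- n) - int 0) vac (nprod (int 0) x y))"
    unfolding associativity_formula
    by (rule Sum_any_eq_single) (use assms in \<open>simp add: vacuum_left nprod_linear\<close>)
  then show ?thesis
    using assms by (simp add: vacuum_left scaleC_one)
qed

text \<open>
  This is the Leibniz rule: \<open>v \<mapsto> v_(-2) vac\<close> is the translation operator \<open>L(-1)\<close>.
\<close>

lemma translation_pair:
  "nprod (-2) (nprod n x (nprod k y vac)) vac =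
    - (of_int n *\<^sub>C nprod (n - 1) x (nprod k y vac)) - of_int k *\<^sub>C nprod n x (nprod (k - 1) y vac)"
proof -
  have D: "nprod 0 conf v = nprod (-2) v vac" for v
    using translation[of "-1" v vac] by (simp add: creation scaleC_one)
  have 0: "((0::complex) gchoose i) = 0" if "i \<noteq> 0" for i
    using that by (cases i) simp_all
  have deriv: "nprod 0 conf (nprod q a b) = - (of_int q *\<^sub>C nprod (q - 1) a b) + nprod q a (nprod 0 conf b)"
    for q a b
  proof -
    have "nprod 0 conf (nprod q a b) - nprod q a (nprod 0 conf b) = nprod q (nprod 0 conf a) b"
      unfolding commutator_formula
      using Sum_any_eq_single[where j = "0::nat" and f = "\<lambda>i. (of_int 0 gchoose i) *\<^sub>C
          nprod (0 + q - int i) (nprod (int i) conf a) b"]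
      by (simp add: 0 scaleC_one)
    then show ?thesis by (simp add: translation algebra_simps)
  qed
  have "clinear (nprod n x)" by (rule clinear_nprod)
  from clinear_diff[OF this, of 0] have neg: "nprod n x (- v) = - nprod n x v" for v
    by (simp add: nprod_linear)
  show ?thesis
    unfolding D[symmetric] by (simp add: deriv creation_regular neg nprod_linear)
qed

definition nth_power :: "'a \<Rightarrow> nat \<Rightarrow> 'a"
  where "nth_power a k = (nprod (-1) a ^^ k) vac"

lemma nth_power_simps [simp]:
  "nth_power a 0 = vac" "nth_power a (Suc k) = nprod (-1) a (nth_power a k)"
  by (simp_all add: nth_power_def)

lemma nth_power_wspace: "a \<in> wspace d \<Longrightarrow> nth_power a k \<in> wspace (int k * d)"
proof (induction k)
  case 0
  show ?case by (simp add: vac_wspace)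
next
  case (Suc k)
  then show ?case using nprod_wspace[of a d "nth_power a k" "int k * d" "-1"]
    by (simp add: algebra_simps)
qed

end

context strongly_generated_voa
begin

lemma commutative_modulo_Fil:
  assumes "a \<in> Fil p" "b \<in> Fil q" "c \<in> Fil l"
  shows "nprod (-1) a (nprod (-1) b c) - nprod (-1) b (nprod (-1) a c) \<in> Fil (p + q + l - 1)"
  unfolding commutator_formula
  by (intro Sum_any_in_subspace csubspace_Fil Fil_scale
      nprod_in_Fil[OF nprod_nonneg_in_Fil[OF assms(1,2), where k = "p + q - 1"] assms(3)]) auto

lemma skew_symmetry_modulo_Fil:
  assumes "a \<in> Fil p" "b \<in> Fil q"
  shows "nprod (-1) a b - nprod (-1) b a \<in> Fil (p + q - 1)"
  using commutative_modulo_Fil[OF assms vac_in_Fil[of 0]] by (simp add: creation)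

lemma associative_modulo_Fil:
  assumes "a \<in> Fil p" "b \<in> Fil q" "c \<in> Fil l"
  shows "nprod (-1) (nprod (-1) a b) c - nprod (-1) a (nprod (-1) b c) \<in> Fil (p + q + l - 1)"
proof -
  define f where "f i = ((-1) ^ i * (of_int (- 1) gchoose i)) *\<^sub>C
         (nprod (- 1 - int i) a (nprod (- 1 + int i) b c)
          - ((-1) powi (- 1)) *\<^sub>C nprod (- 1 + (- 1) - int i) b (nprod (int i) a c))" for i
  have fin: "finite {i. f i \<noteq> 0}"
    unfolding f_def by (rule finite_associativity_support)
  have second: "nprod n b (nprod (int i) a c) \<in> Fil (p + q + l - 1)" for n i
    by (rule nprod_in_Fil[OF assms(2) nprod_nonneg_in_Fil[OF assms(1,3), where k = "p + l - 1"]]) auto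
  have f_in: "f i \<in> Fil (p + q + l - 1)" if "i > 0" for i
    unfolding f_def using that
    by (intro Fil_scale Fil_diff second
        nprod_in_Fil[OF assms(1) nprod_nonneg_in_Fil[OF assms(2,3), where k = "q + l - 1"]]) auto
  have "nprod (-1) (nprod (-1) a b) c = sum f (insert 0 {i. f i \<noteq> 0})"
    unfolding associativity_formula f_def[symmetric]
    using fin by (intro Sum_any.expand_superset) auto
  also have "\<dots> = f 0 + sum f ({i. f i \<noteq> 0} - {0})"
    using fin by (simp add: sum.insert_remove)
  also have "f 0 = nprod (-1) a (nprod (-1) b c) + nprod (-2) b (nprod (int 0) a c)"
    unfolding f_def by (simp add: scaleC_one)
  finally have "nprod (-1) (nprod (-1) a b) c - nprod (-1) a (nprod (-1) b c) =
      nprod (-2) b (nprod (int 0) a c) + sum f ({i. f i \<noteq> 0} - {0})" by simp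
  moreover have "sum f ({i. f i \<noteq> 0} - {0}) \<in> Fil (p + q + l - 1)"
    using f_in by (intro complex_vector.subspace_sum) auto
  ultimately show ?thesis
    using second[of "-2" 0] Fil_add by simp
qed

lemma funpow_in_Fil:
  assumes "a \<in> Fil p" "c \<in> Fil l"
  shows "(nprod (-1) a ^^ k) c \<in> Fil (int k * p + l)"
proof (induction k)
  case 0
  then show ?case using assms by simp
next
  case (Suc k)
  then show ?case using nprod_in_Fil[OF assms(1) Suc] by (simp add: algebra_simps)
qed

lemma nth_power_in_Fil: "a \<in> Fil p \<Longrightarrow> nth_power a k \<in> Fil (int k * p)"
  using funpow_in_Fil[of a p vac 0] vac_in_Fil by (simp add: nth_power_def)

lemma funpow_commute_modulo_Fil:
  assumes "a \<in> Fil p" "b \<in> Fil q" "c \<in> Fil l"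
  shows "nprod (-1) b ((nprod (-1) a ^^ k) c) - (nprod (-1) a ^^ k) (nprod (-1) b c)
    \<in> Fil (int k * p + q + l - 1)"
proof (induction k)
  case 0
  show ?case by (simp add: Fil_0)
next
  case (Suc k)
  let ?u = "(nprod (-1) a ^^ k) c" and ?v = "(nprod (-1) a ^^ k) (nprod (-1) b c)"
  have 1: "nprod (-1) b (nprod (-1) a ?u) - nprod (-1) a (nprod (-1) b ?u)
      \<in> Fil (int (Suc k) * p + q + l - 1)"
    using commutative_modulo_Fil[OF assms(2,1) funpow_in_Fil[OF assms(1,3)], of k]
    by (simp add: algebra_simps)
  have 2: "nprod (-1) a (nprod (-1) b ?u - ?v) \<in> Fil (int (Suc k) * p + q + l - 1)"
    by (rule nprod_in_Fil[OF assms(1) Suc]) (simp add: algebra_simps)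
  from Fil_add[OF 1 2] show ?case by (simp add: nprod_linear)
qed

text \<open>
  The rule \<open>(a b)^k = a^k b^k\<close> of the commutative algebra that \<open>V\<close> becomes up to lower degree.
\<close>

lemma nth_power_nprod_modulo_Fil:
  assumes "a \<in> Fil p" "b \<in> Fil q"
  shows "nth_power (nprod (-1) a b) k - (nprod (-1) a ^^ k) (nth_power b k)
    \<in> Fil (int k * (p + q) - 1)"
proof (induction k)
  case 0
  show ?case by (simp add: Fil_0)
next
  case (Suc k)
  let ?ab = "nprod (-1) a b" and ?u = "(nprod (-1) a ^^ k) (nth_power b k)"
  let ?l = "int (Suc k) * (p + q) - 1"
  have u: "?u \<in> Fil (int k * p + int k * q)"
    by (rule funpow_in_Fil[OF assms(1) nth_power_in_Fil[OF assms(2)]])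
  have "nprod (-1) ?ab (nth_power ?ab k - ?u) \<in> Fil ?l"
    by (rule nprod_in_Fil[OF nprod_in_Fil[OF assms order_refl] Suc]) (simp add: algebra_simps)
  moreover have "nprod (-1) ?ab ?u - nprod (-1) a (nprod (-1) b ?u) \<in> Fil ?l"
    using associative_modulo_Fil[OF assms u] by (simp add: algebra_simps)
  moreover have "nprod (-1) a (nprod (-1) b ?u - (nprod (-1) a ^^ k) (nprod (-1) b (nth_power b k))) \<in> Fil ?l"
    by (rule nprod_in_Fil[OF assms(1) funpow_commute_modulo_Fil[OF assms nth_power_in_Fil[OF assms(2)]]])
      (simp add: algebra_simps)
  ultimately have "nprod (-1) ?ab (nth_power ?ab k - ?u) + (nprod (-1) ?ab ?u - nprod (-1) a (nprod (-1) b ?u))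
     + nprod (-1) a (nprod (-1) b ?u - (nprod (-1) a ^^ k) (nprod (-1) b (nth_power b k))) \<in> Fil ?l"
    by (intro Fil_add)
  then show ?case by (simp add: nprod_linear)
qed

text \<open>
  For large \<open>w\<close> the finitely many vectors that complement \<open>C2\<close> have no component of weight \<open>w\<close>, so a
  vector of weight \<open>w\<close> is a sum of products \<open>u_(-2) v\<close> of homogeneous vectors of total weight \<open>w - 1\<close>.
\<close>

lemma wspace_drops_eventually:
  assumes "C2_cofinite nprod UNIV"
  shows "\<exists>M. \<forall>w\<ge>M. wspace w \<subseteq> Fil (w - 1)"
proof -
  define S where "S i = {nprod (-2) u v | u v p q. u \<in> wspace p \<and> v \<in> wspace q \<and> p + q + 1 = i}" for i :: int
  have S_w: "S i \<subseteq> wspace i" for i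
    using nprod_wspace[of _ _ _ _ "-2"] by (fastforce simp: S_def algebra_simps)
  have S_F: "S i \<subseteq> Fil (i - 1)" for i
    using wspace_subset_Fil by (auto simp: S_def intro!: nprod_in_Fil)
  have all: "u \<in> cspan (\<Union>p. wspace p)" for u
  proof -
    have "(\<Union>d. weight_space nprod conf d) \<subseteq> (\<Union>p. wspace p)"
      by (auto simp: weight_space_eq_wspace)
    from complex_vector.span_mono[OF this] show ?thesis using grading by auto
  qed
  have hom: "nprod (-2) u v \<in> cspan (\<Union>i. S i)" if u: "u \<in> wspace p" for u v p
    using all[of v]
  proof (induction rule: complex_vector.span_induct_alt)
    case base
    show ?case by (simp add: nprod_linear complex_vector.span_zero)
  next
    case (step c x y)
    then have "nprod (-2) u x \<in> (\<Union>i. S i)" using u unfolding S_def by blast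
    with step show ?case
      by (simp add: nprod_linear complex_vector.span_add complex_vector.span_scale complex_vector.span_base)
  qed
  have "nprod (-2) u v \<in> cspan (\<Union>i. S i)" for u v
    using all[of u]
  proof (induction rule: complex_vector.span_induct_alt)
    case base
    show ?case by (simp add: nprod_linear complex_vector.span_zero)
  next
    case (step c x y)
    then show ?case
      using hom by (auto simp: nprod_linear complex_vector.span_add complex_vector.span_scale)
  qed
  then have C2S: "C2 nprod UNIV \<subseteq> cspan (\<Union>i. S i)"
    unfolding C2_def by (intro complex_vector.span_minimal) auto
  obtain F where F: "finite F" "UNIV \<subseteq> cspan (C2 nprod UNIV \<union> F)"
    using assms C2_cofinite_iff[of UNIV nprod] by (auto simp: complex_vector.subspace_UNIV)
  have below: "\<exists>M. f \<in> cspan (\<Union>i\<in>{..<M}. wspace i)" for f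
    using all[of f]
  proof (induction rule: complex_vector.span_induct_alt)
    case base
    show ?case by (simp add: complex_vector.span_zero)
  next
    case (step c x y)
    then obtain M p where M: "y \<in> cspan (\<Union>i\<in>{..<M}. wspace i)" and p: "x \<in> wspace p" by blast
    have "x \<in> (\<Union>i\<in>{..<max M (p + 1)}. wspace i)" using p by auto
    moreover have "cspan (\<Union>i\<in>{..<M}. wspace i) \<subseteq> cspan (\<Union>i\<in>{..<max M (p + 1)}. wspace i)"
      by (rule complex_vector.span_mono, rule UN_mono) auto
    ultimately have "c *\<^sub>C x + y \<in> cspan (\<Union>i\<in>{..<max M (p + 1)}. wspace i)"
      using M by (auto intro: complex_vector.span_add complex_vector.span_scale complex_vector.span_base)
    then show ?case ..
  qed
  then obtain m where m: "\<And>f. f \<in> cspan (\<Union>i\<in>{..<m f}. wspace i)" by metis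
  define M where "M = Max (insert 0 (m ` F))"
  have FM: "F \<subseteq> cspan (\<Union>i\<in>{..<M}. wspace i)"
  proof
    fix f assume "f \<in> F"
    then have "m f \<le> M" using F(1) by (simp add: M_def)
    then have "cspan (\<Union>i\<in>{..<m f}. wspace i) \<subseteq> cspan (\<Union>i\<in>{..<M}. wspace i)"
      by (intro complex_vector.span_mono UN_mono) auto
    with m show "f \<in> cspan (\<Union>i\<in>{..<M}. wspace i)" by blast
  qed
  \<comment> \<open>The span of \<open>F\<close> only has components of weight below \<open>M\<close>. Allowing all vectors of
    those weights makes the spanning family homogeneous.\<close>
  define S' where "S' i = S i \<union> (if i < M then wspace i else {})" for i
  have "cspan (\<Union>i. S i) \<subseteq> cspan (\<Union>i. S' i)" "cspan (\<Union>i\<in>{..<M}. wspace i) \<subseteq> cspan (\<Union>i. S' i)"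
    by (rule complex_vector.span_mono; force simp: S'_def)+
  with C2S FM have "cspan (C2 nprod UNIV \<union> F) \<subseteq> cspan (\<Union>i. S' i)"
    by (intro complex_vector.span_minimal) auto
  with F(2) have span: "v \<in> cspan (\<Union>i. S' i)" for v by blast
  have "wspace w \<subseteq> Fil (w - 1)" if "w \<ge> M" for w
  proof
    fix v assume v: "v \<in> wspace w"
    have "v \<in> cspan (S' w)"
    proof (rule eigenvector_in_span_of_own_weight[OF clinear_nprod[of 1 conf] _ span])
      show "nprod 1 conf s = of_int i *\<^sub>C s" if "s \<in> S' i" for s i
        using that S_w[of i] by (auto simp: S'_def wspace_def split: if_splits)
      show "nprod 1 conf v = of_int w *\<^sub>C v"
        using v by (simp add: wspace_def)
    qed
    moreover have "cspan (S' w) \<subseteq> Fil (w - 1)"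
      using S_F[of w] that by (intro complex_vector.span_minimal) (auto simp: S'_def)
    ultimately show "v \<in> Fil (w - 1)" ..
  qed
  then show ?thesis by blast
qed

text \<open>
  The expected degree of \<open>x^k\<close> equals its weight \<open>k * wt x\<close>, which exceeds any bound as \<open>wt x \<ge> 1\<close>.
\<close>

lemma generator_nilpotent_modulo_Fil:
  assumes "C2_cofinite nprod UNIV" "x \<in> T"
  shows "\<exists>k. nth_power x k \<in> Fil (int k * int (wt x) - 1)"
proof -
  obtain M where M: "\<And>w. w \<ge> M \<Longrightarrow> wspace w \<subseteq> Fil (w - 1)"
    using wspace_drops_eventually[OF assms(1)] by blast
  have "int (nat M) * 1 \<le> int (nat M) * int (wt x)"
    using wt_pos[OF assms(2)] by (intro mult_left_mono) auto
  then have "int (nat M) * int (wt x) \<ge> M" by linarith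
  moreover have "nth_power x (nat M) \<in> wspace (int (nat M) * int (wt x))"
    using homogeneous[OF assms(2)] by (intro nth_power_wspace) (simp add: weight_space_eq_wspace)
  ultimately show ?thesis using M by blast
qed

text \<open>
  The weight of \<open>x_(-n) y\<close> exceeds its degree if \<open>n > 1\<close>, so the weight argument for a generator does
  not apply. But up to lower degree the \<open>k\<close>-th power is \<open>X^k y^k\<close> with \<open>X = x_(-n) vac\<close>, and
  nilpotency of \<open>y\<close> is enough.
\<close>

lemma generator_pair_nilpotent_modulo_Fil:
  assumes "C2_cofinite nprod UNIV" "x \<in> T" "y \<in> T" "n \<ge> 1"
  shows "\<exists>k. nth_power (nprod (- int n) x y) k \<in> Fil (int k * int (wt x + wt y) - 1)"
proof -
  obtain k where k: "nth_power y k \<in> Fil (int k * int (wt y) - 1)"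
    using generator_nilpotent_modulo_Fil[OF assms(1,3)] by blast
  let ?X = "nprod (- int n) x vac"
  have X: "?X \<in> Fil (int (wt x))"
    using generator_nprod_in_Fil[OF assms(2) _ vac_in_Fil[of 0], of "- int n"] assms(4) by simp
  have eq: "nprod (- int n) x y = nprod (-1) ?X y"
    using nprod_creation_field[of "int n" x y] assms(4) by simp
  have 1: "nth_power (nprod (-1) ?X y) k - (nprod (-1) ?X ^^ k) (nth_power y k)
      \<in> Fil (int k * int (wt x + wt y) - 1)"
    using nth_power_nprod_modulo_Fil[OF X generator_in_Fil[OF assms(3)], of k] by simp
  have 2: "(nprod (-1) ?X ^^ k) (nth_power y k) \<in> Fil (int k * int (wt x + wt y) - 1)"
    using funpow_in_Fil[OF X k] by (simp add: algebra_simps)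
  show ?thesis
    unfolding eq using Fil_add[OF 1 2] by auto
qed

end

section \<open>Products on the tensor square\<close>

lemma clinear_sum: "clinear f \<Longrightarrow> f (sum g A) = (\<Sum>i\<in>A. f (g i))"
  by (induction A rule: infinite_finite_induct) (simp_all add: clinear_0 clinear_add)

lemma clinear_Sum_any:
  assumes "clinear f" "finite {i. g i \<noteq> 0}"
  shows "f (Sum_any g) = Sum_any (\<lambda>i. f (g i))"
proof -
  have "Sum_any (\<lambda>i. f (g i)) = (\<Sum>i\<in>{i. g i \<noteq> 0}. f (g i))"
    using assms by (intro Sum_any.expand_superset) (auto simp: clinear_0)
  then show ?thesis by (simp add: Sum_any.expand_set clinear_sum[OF assms(1)])
qed

text \<open>
  The claim about the support is carried along in the induction.
\<close>

lemma Sum_any_sum: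
  assumes "\<And>k. k \<in> K \<Longrightarrow> finite {i. f k i \<noteq> (0::'a::comm_monoid_add)}"
  shows "Sum_any (\<lambda>i. \<Sum>k\<in>K. f k i) = (\<Sum>k\<in>K. Sum_any (f k))"
proof -
  have "Sum_any (\<lambda>i. \<Sum>k\<in>K. f k i) = (\<Sum>k\<in>K. Sum_any (f k)) \<and> finite {i. (\<Sum>k\<in>K. f k i) \<noteq> 0}"
    using assms
  proof (induction K rule: infinite_finite_induct)
    case (insert x F)
    then have fin: "finite {i. f x i \<noteq> 0}" "finite {i. (\<Sum>k\<in>F. f k i) \<noteq> 0}" by auto
    have "{i. f x i + (\<Sum>k\<in>F. f k i) \<noteq> 0} \<subseteq> {i. f x i \<noteq> 0} \<union> {i. (\<Sum>k\<in>F. f k i) \<noteq> 0}" by auto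
    with fin have "finite {i. f x i + (\<Sum>k\<in>F. f k i) \<noteq> 0}"
      by (meson finite_Un finite_subset)
    with insert fin show ?case by (simp add: Sum_any.distrib)
  qed auto
  then show ?thesis ..
qed

lemma Sum_any_shift: "Sum_any (\<lambda>i::int. f (i + k)) = Sum_any f"
proof (rule Sum_any.reindex_cong[symmetric])
  show "bij (\<lambda>i::int. i + k)"
    by (rule o_bij[where g = "\<lambda>i. i - k"]) (auto simp: fun_eq_iff)
qed auto

lemma clinear_tensor_pair: "clinear (\<lambda>b. a \<otimes> b)"
  and clinear_tensor_pair_left: "clinear (\<lambda>a. a \<otimes> b)"
  using cbilinear_tensor_pair unfolding cbilinear_def by blast+

lemmas tensor_pair_linear =
  clinear_add[OF clinear_tensor_pair] clinear_add[OF clinear_tensor_pair_left]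
  clinear_diff[OF clinear_tensor_pair] clinear_diff[OF clinear_tensor_pair_left]
  clinear_scale[OF clinear_tensor_pair] clinear_scale[OF clinear_tensor_pair_left]
  clinear_0[OF clinear_tensor_pair] clinear_0[OF clinear_tensor_pair_left]

lemma tensor_induct [case_names zero add]:
  fixes t :: "('a::complex_vector, 'b::complex_vector) tensor"
  assumes "P 0" and "\<And>a b t. P t \<Longrightarrow> P (a \<otimes> b + t)"
  shows "P t"
proof (induct t rule: tensor.abs_induct)
  case (1 p)
  show ?case
  proof (induction p rule: update_induct)
    case const
    show ?case using assms(1) by (simp add: zero_tensor.abs_eq)
  next
    case (update f k c)
    have "Poly_Mapping.update k c f = c *\<^sub>C Poly_Mapping.single k 1 + f"
    proof (rule poly_mapping_eqI)
      fix l
      have "Poly_Mapping.lookup (c *\<^sub>C Poly_Mapping.single k (1::complex)) l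
          = c * Poly_Mapping.lookup (Poly_Mapping.single k 1) l"
        by transfer (simp add: scaleC_complex_def)
      with update show "Poly_Mapping.lookup (Poly_Mapping.update k c f) l =
          Poly_Mapping.lookup (c *\<^sub>C Poly_Mapping.single k 1 + f) l"
        by (auto simp: lookup_update lookup_add lookup_single in_keys_iff when_def)
    qed
    then have "abs_tensor (Poly_Mapping.update k c f) = c *\<^sub>C (fst k \<otimes> snd k) + abs_tensor f"
      by (simp add: plus_tensor.abs_eq[symmetric] scaleC_tensor.abs_eq[symmetric] tensor_pair.abs_eq)
    also have "\<dots> = (c *\<^sub>C fst k) \<otimes> snd k + abs_tensor f"
      by (simp add: tensor_pair_linear)
    finally show ?case using assms(2) update by simp
  qed
qed

lemma tensor_linear_eqI:
  assumes "clinear f" "clinear g" "\<And>a b. f (a \<otimes> b) = g (a \<otimes> b)"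
  shows "f t = g t"
  by (induction t rule: tensor_induct) (simp_all add: assms clinear_0 clinear_add)

lemma tensor_swap_swap: "tensor_swap (tensor_swap t) = t"
  by (rule tensor_linear_eqI[where f = "\<lambda>t. tensor_swap (tensor_swap t)" and g = "\<lambda>t. t"])
    (auto intro!: clinearI simp: tensor_swap_pair clinear_add[OF clinear_tensor_swap]
      clinear_scale[OF clinear_tensor_swap])

lemma csubspace_swap_fixed: "csubspace swap_fixed"
  unfolding swap_fixed_def by (rule complex_vector.subspaceI)
    (simp_all add: clinear_0[OF clinear_tensor_swap] clinear_add[OF clinear_tensor_swap]
      clinear_scale[OF clinear_tensor_swap])

context vertex_operator_algebra
begin

abbreviation tprod :: "int \<Rightarrow> ('a, 'a) tensor \<Rightarrow> ('a, 'a) tensor \<Rightarrow> ('a, 'a) tensor"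
  where "tprod \<equiv> tensor_nprod nprod"

lemma finite_tensor_support: "finite {i::int. nprod (i + j) a u \<otimes> nprod (k - i) b v \<noteq> 0}"
proof -
  obtain M N where M: "\<And>i. i \<ge> M \<Longrightarrow> nprod i a u = 0" and N: "\<And>i. i \<ge> N \<Longrightarrow> nprod i b v = 0"
    using truncation by meson
  have "i \<in> {k - N..M - j}" if "nprod (i + j) a u \<otimes> nprod (k - i) b v \<noteq> 0" for i
  proof (rule ccontr)
    assume "i \<notin> {k - N..M - j}"
    then have "i + j \<ge> M \<or> k - i \<ge> N" by auto
    with that M N show False by (auto simp: tensor_pair_linear)
  qed
  then have "{i. nprod (i + j) a u \<otimes> nprod (k - i) b v \<noteq> 0} \<subseteq> {k - N..M - j}" by blast
  then show ?thesis by (rule finite_subset) simp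
qed

lemmas finite_tensor_support_0 = finite_tensor_support[of 0, simplified]

lemma clinear_pair_product:
  shows "clinear (\<lambda>a. Sum_any (\<lambda>i::int. nprod i a u \<otimes> nprod (k - i) b v))"
    and "clinear (\<lambda>b. Sum_any (\<lambda>i::int. nprod i a u \<otimes> nprod (k - i) b v))"
    and "clinear (\<lambda>u. Sum_any (\<lambda>i::int. nprod i a u \<otimes> nprod (k - i) b v))"
    and "clinear (\<lambda>v. Sum_any (\<lambda>i::int. nprod i a u \<otimes> nprod (k - i) b v))"
proof -
  have scale: "clinear (\<lambda>x. c *\<^sub>C x)" for c :: complex
    by (rule clinearI) (simp_all add: scaleC_add_right scaleC_scaleC mult.commute)
  note * = clinear_Sum_any[OF scale finite_tensor_support_0]
  show "clinear (\<lambda>a. Sum_any (\<lambda>i::int. nprod i a u \<otimes> nprod (k - i) b v))"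
    "clinear (\<lambda>b. Sum_any (\<lambda>i::int. nprod i a u \<otimes> nprod (k - i) b v))"
    "clinear (\<lambda>u. Sum_any (\<lambda>i::int. nprod i a u \<otimes> nprod (k - i) b v))"
    "clinear (\<lambda>v. Sum_any (\<lambda>i::int. nprod i a u \<otimes> nprod (k - i) b v))"
    by (rule clinearI; simp add: nprod_linear tensor_pair_linear * 
        Sum_any.distrib[OF finite_tensor_support_0 finite_tensor_support_0])+
qed

lemma cbilinear_pair_product:
  "cbilinear (\<lambda>u v. Sum_any (\<lambda>i::int. nprod i a u \<otimes> nprod (k - i) b v))"
  using clinear_pair_product(3,4) by (simp add: cbilinear_def)

lemma cbilinear_tprod_left_factor:
  "cbilinear (\<lambda>a b. tensor_lift (\<lambda>u v. Sum_any (\<lambda>i::int. nprod i a u \<otimes> nprod (k - i) b v)) y)"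
proof (induction y rule: tensor_induct)
  case zero
  then show ?case
    by (simp add: cbilinear_def clinear_0[OF clinear_tensor_lift[OF cbilinear_pair_product]] clinearI)
next
  case (add u v t)
  define G where "G a b = tensor_lift (\<lambda>u v. Sum_any (\<lambda>i::int. nprod i a u \<otimes> nprod (k - i) b v)) t" for a b
  from add have G: "clinear (\<lambda>a. G a b)" "clinear (\<lambda>b. G a b)" for a b
    by (auto simp: cbilinear_def G_def)
  show ?case
    unfolding cbilinear_def clinear_add[OF clinear_tensor_lift[OF cbilinear_pair_product]]
      tensor_lift_pair[OF cbilinear_pair_product] G_def[symmetric]
    by (intro conjI allI clinearI)
      (simp_all add: clinear_add[OF clinear_pair_product(1)] clinear_add[OF clinear_pair_product(2)]
        clinear_scale[OF clinear_pair_product(1)] clinear_scale[OF clinear_pair_product(2)]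
        clinear_add[OF G(1)] clinear_add[OF G(2)] clinear_scale[OF G(1)] clinear_scale[OF G(2)]
        scaleC_add_right)
qed

lemma clinear_tprod_left: "clinear (\<lambda>x. tprod n x y)"
  unfolding tensor_nprod_def by (rule clinear_tensor_lift[OF cbilinear_tprod_left_factor])

lemma clinear_tprod: "clinear (tprod n x)"
proof (induction x rule: tensor_induct)
  case zero
  then show ?case by (simp add: clinear_0[OF clinear_tprod_left] clinearI)
next
  case (add a b t)
  have *: "tprod n (a \<otimes> b) y = tensor_lift (\<lambda>u v. Sum_any (\<lambda>i::int. nprod i a u \<otimes> nprod (n - 1 - i) b v)) y" for y
    unfolding tensor_nprod_def by (rule tensor_lift_pair[OF cbilinear_tprod_left_factor])
  show ?case
    by (rule clinearI) (simp_all add: clinear_add[OF clinear_tprod_left] *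
        clinear_add[OF clinear_tensor_lift[OF cbilinear_pair_product]]
        clinear_scale[OF clinear_tensor_lift[OF cbilinear_pair_product]]
        clinear_add[OF add] clinear_scale[OF add] scaleC_add_right)
qed

lemmas tprod_linear =
  clinear_add[OF clinear_tprod] clinear_add[OF clinear_tprod_left]
  clinear_diff[OF clinear_tprod] clinear_diff[OF clinear_tprod_left]
  clinear_scale[OF clinear_tprod] clinear_scale[OF clinear_tprod_left]
  clinear_0[OF clinear_tprod] clinear_0[OF clinear_tprod_left]

text \<open>
  The swap is an automorphism. It transports identities for the operators \<open>a \<otimes> vac\<close> to the operators
  \<open>vac \<otimes> a\<close>, so only the former are computed.
\<close>

lemma tensor_swap_tprod: "tensor_swap (tprod n x y) = tprod n (tensor_swap x) (tensor_swap y)"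
proof (induction x rule: tensor_induct)
  case zero
  show ?case by (simp add: tprod_linear clinear_0[OF clinear_tensor_swap])
next
  case (add a b t)
  have "tensor_swap (tprod n (a \<otimes> b) y) = tprod n (b \<otimes> a) (tensor_swap y)"
  proof (induction y rule: tensor_induct)
    case zero
    show ?case by (simp add: tprod_linear clinear_0[OF clinear_tensor_swap])
  next
    case (add u v s)
    have "bij (\<lambda>i. n - 1 - i)"
      by (rule o_bij[where g = "\<lambda>i. n - 1 - i"]) (auto simp: fun_eq_iff)
    then have "Sum_any (\<lambda>i. nprod i b v \<otimes> nprod (n - 1 - i) a u)
        = Sum_any (\<lambda>i. nprod (n - 1 - i) b v \<otimes> nprod i a u)"
      by (rule Sum_any.reindex_cong) (auto simp: fun_eq_iff)
    then have "tensor_swap (tprod n (a \<otimes> b) (u \<otimes> v)) = tprod n (b \<otimes> a) (v \<otimes> u)"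
      by (simp add: tensor_nprod_pair clinear_Sum_any[OF clinear_tensor_swap finite_tensor_support_0]
          tensor_swap_pair)
    with add show ?case
      by (simp add: tprod_linear clinear_add[OF clinear_tensor_swap] tensor_swap_pair)
  qed
  with add show ?case
    by (simp add: tprod_linear clinear_add[OF clinear_tensor_swap] tensor_swap_pair)
qed

lemma tprod_swap_fixed: "x \<in> swap_fixed \<Longrightarrow> y \<in> swap_fixed \<Longrightarrow> tprod n x y \<in> swap_fixed"
  by (simp add: swap_fixed_def tensor_swap_tprod)

lemma tprod_first_factor: "tprod n (a \<otimes> vac) (u \<otimes> v) = nprod n a u \<otimes> v"
proof -
  have "tprod n (a \<otimes> vac) (u \<otimes> v) = nprod n a u \<otimes> nprod (n - 1 - n) vac v"
    unfolding tensor_nprod_pair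
    by (rule Sum_any_eq_single) (simp add: vacuum_left tensor_pair_linear)
  then show ?thesis by (simp add: vacuum_left)
qed

lemma tprod_eta: "tprod n (eta vac a) (u \<otimes> v) = nprod n a u \<otimes> v + u \<otimes> nprod n a v"
proof -
  have "tprod n (vac \<otimes> a) (u \<otimes> v) = tensor_swap (tprod n (a \<otimes> vac) (v \<otimes> u))"
    by (simp add: tensor_swap_tprod tensor_swap_pair)
  then show ?thesis
    by (simp add: eta_def tprod_linear tprod_first_factor tensor_swap_pair)
qed

text \<open>
  The sum over \<open>k\<close> is finite, as \<open>a_(k) b = 0\<close> for large \<open>k\<close>, but its length depends on the tensors.
  Stating the identity for all sufficiently long sums makes it stable under addition, so that it
  extends from pure tensors to all tensors.
\<close>

lemma first_factor_commutator_pure: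
  "\<forall>\<^sub>F M in sequentially.
    tprod m (a \<otimes> vac) (tprod n (b \<otimes> c) (u \<otimes> v)) - tprod n (b \<otimes> c) (tprod m (a \<otimes> vac) (u \<otimes> v)) =
    (\<Sum>k<M. (of_int m gchoose k) *\<^sub>C
      tprod (m + n - int k) (tprod (int k) (a \<otimes> vac) (b \<otimes> c)) (u \<otimes> v))"
proof -
  obtain K where K: "\<And>k. k \<ge> K \<Longrightarrow> nprod k a b = 0" using truncation by blast
  have "tprod m (a \<otimes> vac) (tprod n (b \<otimes> c) (u \<otimes> v)) - tprod n (b \<otimes> c) (tprod m (a \<otimes> vac) (u \<otimes> v)) =
    (\<Sum>k<M. (of_int m gchoose k) *\<^sub>C
      tprod (m + n - int k) (tprod (int k) (a \<otimes> vac) (b \<otimes> c)) (u \<otimes> v))" if M: "M \<ge> nat K" for M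
  proof -
    define g where "g k i = (of_int m gchoose k) *\<^sub>C
        (nprod (i + (m - int k)) (nprod (int k) a b) u \<otimes> nprod (n - 1 - i) c v)" for k :: nat and i
    have fing: "finite {i. g k i \<noteq> 0}" for k
      by (rule finite_subset[OF _ finite_tensor_support[of "m - int k" "nprod (int k) a b" u "n - 1" c v]])
        (auto simp: g_def)
    have Vcomm: "nprod m a (nprod i b u) - nprod i b (nprod m a u) =
        (\<Sum>k<M. (of_int m gchoose k) *\<^sub>C nprod (m + i - int k) (nprod (int k) a b) u)" for i
      unfolding commutator_formula
    proof (rule Sum_any.expand_superset)
      show "{k. (of_int m gchoose k) *\<^sub>C nprod (m + i - int k) (nprod (int k) a b) u \<noteq> 0} \<subseteq> {..<M}"
      proof (rule subsetI, rule ccontr)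
        fix k assume k: "k \<in> {k. (of_int m gchoose k) *\<^sub>C nprod (m + i - int k) (nprod (int k) a b) u \<noteq> 0}"
          "k \<notin> {..<M}"
        then have "int k \<ge> K" using M by auto
        with k K show False by (simp add: nprod_linear)
      qed
    qed simp
    have fin1: "finite {i. nprod m a (nprod i b u) \<otimes> nprod (n - 1 - i) c v \<noteq> 0}"
      by (rule finite_subset[OF _ finite_tensor_support_0[of b u "n - 1" c v]])
        (auto simp: nprod_linear tensor_pair_linear
          dest: arg_cong[where f = "\<lambda>t. tprod m (a \<otimes> vac) t"] simp: tprod_first_factor tprod_linear)
    have "tprod m (a \<otimes> vac) (tprod n (b \<otimes> c) (u \<otimes> v)) =
        Sum_any (\<lambda>i. nprod m a (nprod i b u) \<otimes> nprod (n - 1 - i) c v)"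
      by (simp add: tensor_nprod_pair[of n b] clinear_Sum_any[OF clinear_tprod finite_tensor_support_0]
          tprod_first_factor)
    also have "\<dots> = Sum_any (\<lambda>i. (\<Sum>k<M. g k i) + nprod i b (nprod m a u) \<otimes> nprod (n - 1 - i) c v)"
    proof (rule Sum_any.cong)
      fix i
      have "nprod m a (nprod i b u) = (\<Sum>k<M. (of_int m gchoose k) *\<^sub>C nprod (m + i - int k) (nprod (int k) a b) u)
          + nprod i b (nprod m a u)"
        using Vcomm[of i] by (simp add: algebra_simps)
      then show "nprod m a (nprod i b u) \<otimes> nprod (n - 1 - i) c v =
          (\<Sum>k<M. g k i) + nprod i b (nprod m a u) \<otimes> nprod (n - 1 - i) c v"
        by (simp add: tensor_pair_linear clinear_sum[OF clinear_tensor_pair_left] g_def algebra_simps)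
    qed
    also have "\<dots> = Sum_any (\<lambda>i. \<Sum>k<M. g k i)
        + Sum_any (\<lambda>i. nprod i b (nprod m a u) \<otimes> nprod (n - 1 - i) c v)"
    proof (rule Sum_any.distrib)
      show "finite {i. (\<Sum>k<M. g k i) \<noteq> 0}"
        by (rule finite_subset[of _ "\<Union>k<M. {i. g k i \<noteq> 0}"])
          (use fing in \<open>auto elim: sum.not_neutral_contains_not_neutral\<close>)
    qed (rule finite_tensor_support_0)
    also have "Sum_any (\<lambda>i. nprod i b (nprod m a u) \<otimes> nprod (n - 1 - i) c v) =
        tprod n (b \<otimes> c) (tprod m (a \<otimes> vac) (u \<otimes> v))"
      unfolding tprod_first_factor by (simp add: tensor_nprod_pair)
    also have "Sum_any (\<lambda>i. \<Sum>k<M. g k i) = (\<Sum>k<M. Sum_any (g k))"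
      by (rule Sum_any_sum) (rule fing)
    also have "\<dots> = (\<Sum>k<M. (of_int m gchoose k) *\<^sub>C
      tprod (m + n - int k) (tprod (int k) (a \<otimes> vac) (b \<otimes> c)) (u \<otimes> v))"
    proof (rule sum.cong[OF refl])
      fix k
      let ?h = "\<lambda>i. nprod i (nprod (int k) a b) u \<otimes> nprod (m + n - int k - 1 - i) c v"
      have scale: "clinear (\<lambda>x::('a, 'a) tensor. (of_int m gchoose k) *\<^sub>C x)"
        by (rule clinearI) (simp_all add: scaleC_add_right scaleC_scaleC mult.commute)
      have "Sum_any (g k) = Sum_any (\<lambda>i. (of_int m gchoose k) *\<^sub>C ?h (i + (m - int k)))"
        by (rule Sum_any.cong) (simp add: g_def algebra_simps)
      also have "\<dots> = Sum_any (\<lambda>i. (of_int m gchoose k) *\<^sub>C ?h i)"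
        by (rule Sum_any_shift)
      also have "\<dots> = (of_int m gchoose k) *\<^sub>C Sum_any ?h"
        by (rule clinear_Sum_any[OF scale finite_tensor_support_0, symmetric])
      also have "Sum_any ?h = tprod (m + n - int k) (tprod (int k) (a \<otimes> vac) (b \<otimes> c)) (u \<otimes> v)"
        unfolding tprod_first_factor by (simp add: tensor_nprod_pair)
      finally show "Sum_any (g k) = (of_int m gchoose k) *\<^sub>C
        tprod (m + n - int k) (tprod (int k) (a \<otimes> vac) (b \<otimes> c)) (u \<otimes> v)" .
    qed
    finally show ?thesis by simp
  qed
  then show ?thesis unfolding eventually_sequentially by blast
qed

text \<open>
  The length of the sum must not depend on the index \<open>i\<close> of the tensor product formula. Terms with
  \<open>q - 1 - i \<ge> L\<close> vanish, because \<open>c_(q - 1 - i) v = 0\<close>, and for the others \<open>i\<close> is bounded below, so that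
  \<open>b_(i + j) u = 0\<close> from some \<open>j\<close> on that does not depend on \<open>i\<close>.
\<close>

lemma first_factor_associativity_pure:
  "\<forall>\<^sub>F M in sequentially.
    tprod q (tprod (-1) (a \<otimes> vac) (b \<otimes> c)) (u \<otimes> v) =
    (\<Sum>j<M. tprod (- 1 - int j) (a \<otimes> vac) (tprod (q + int j) (b \<otimes> c) (u \<otimes> v)) +
      tprod (q - 1 - int j) (b \<otimes> c) (tprod (int j) (a \<otimes> vac) (u \<otimes> v)))"
proof -
  obtain J where J: "\<And>k. k \<ge> J \<Longrightarrow> nprod k a u = 0" using truncation by blast
  obtain N where N: "\<And>k. k \<ge> N \<Longrightarrow> nprod k b u = 0" using truncation by blast
  obtain L where L: "\<And>k. k \<ge> L \<Longrightarrow> nprod k c v = 0" using truncation by blast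
  have "tprod q (tprod (-1) (a \<otimes> vac) (b \<otimes> c)) (u \<otimes> v) =
    (\<Sum>j<M. tprod (- 1 - int j) (a \<otimes> vac) (tprod (q + int j) (b \<otimes> c) (u \<otimes> v)) +
      tprod (q - 1 - int j) (b \<otimes> c) (tprod (int j) (a \<otimes> vac) (u \<otimes> v)))"
    if M: "M \<ge> nat (max J (N - (q - L)))" for M
  proof -
    define g where "g j i = nprod (- 1 - int j) a (nprod (i + int j) b u) \<otimes> nprod (q - 1 - i) c v" for j :: nat and i
    define h where "h j i = nprod (i + (- 1 - int j)) b (nprod (int j) a u) \<otimes> nprod (q - 1 - i) c v" for j :: nat and i
    have fing: "finite {i. g j i \<noteq> 0}" for j
    proof (rule finite_subset[OF _ finite_tensor_support[of "int j" b u "q - 1" c v]], rule subsetI)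
      fix i assume "i \<in> {i. g j i \<noteq> 0}"
      moreover have "g j i = tprod (- 1 - int j) (a \<otimes> vac) (nprod (i + int j) b u \<otimes> nprod (q - 1 - i) c v)"
        by (simp add: g_def tprod_first_factor)
      ultimately show "i \<in> {i. nprod (i + int j) b u \<otimes> nprod (q - 1 - i) c v \<noteq> 0}"
        by (auto simp: tprod_linear)
    qed
    have finh: "finite {i. h j i \<noteq> 0}" for j
      unfolding h_def by (rule finite_tensor_support)
    have Vassoc: "nprod i (nprod (-1) a b) u \<otimes> nprod (q - 1 - i) c v = (\<Sum>j<M. g j i + h j i)" for i
    proof (cases "q - 1 - i \<ge> L")
      case True
      then show ?thesis by (simp add: L g_def h_def tensor_pair_linear)
    next
      case False
      have coeff: "(-1) ^ j * (of_int (- 1) gchoose j) = (1::complex)" for j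
        using gbinomial_minus[of "1::complex" j] binomial_gbinomial[of j j, where 'a = complex]
        by (simp add: power_mult_distrib[symmetric] mult.assoc[symmetric])
      have "nprod i (nprod (-1) a b) u = Sum_any (\<lambda>j::nat. nprod (- 1 - int j) a (nprod (i + int j) b u)
          + nprod (i + (- 1 - int j)) b (nprod (int j) a u))"
        unfolding associativity_formula
        by (rule Sum_any.cong) (simp only: coeff, simp add: scaleC_one algebra_simps)
      also have "\<dots> = (\<Sum>j<M. nprod (- 1 - int j) a (nprod (i + int j) b u)
          + nprod (i + (- 1 - int j)) b (nprod (int j) a u))"
      proof (rule Sum_any.expand_superset)
        show "{j. nprod (- 1 - int j) a (nprod (i + int j) b u)
          + nprod (i + (- 1 - int j)) b (nprod (int j) a u) \<noteq> 0} \<subseteq> {..<M}"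
        proof (rule subsetI, rule ccontr)
          fix j assume j: "j \<in> {j. nprod (- 1 - int j) a (nprod (i + int j) b u)
            + nprod (i + (- 1 - int j)) b (nprod (int j) a u) \<noteq> 0}" "j \<notin> {..<M}"
          then have "int j \<ge> J" "i + int j \<ge> N" using M False by auto
          with j(1) show False by (simp add: J N nprod_linear)
        qed
      qed simp
      finally show ?thesis
        by (simp add: clinear_sum[OF clinear_tensor_pair_left] tensor_pair_linear g_def h_def)
    qed
    have "tprod q (tprod (-1) (a \<otimes> vac) (b \<otimes> c)) (u \<otimes> v) = Sum_any (\<lambda>i. \<Sum>j<M. g j i + h j i)"
      unfolding tprod_first_factor unfolding tensor_nprod_pair Vassoc ..
    also have "\<dots> = (\<Sum>j<M. Sum_any (\<lambda>i. g j i + h j i))"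
    proof (rule Sum_any_sum)
      fix j
      show "finite {i. g j i + h j i \<noteq> 0}"
        by (rule finite_subset[OF _ finite_UnI[OF fing[of j] finh[of j]]]) auto
    qed
    also have "\<dots> = (\<Sum>j<M. tprod (- 1 - int j) (a \<otimes> vac) (tprod (q + int j) (b \<otimes> c) (u \<otimes> v)) +
      tprod (q - 1 - int j) (b \<otimes> c) (tprod (int j) (a \<otimes> vac) (u \<otimes> v)))"
    proof (rule sum.cong[OF refl])
      fix j
      let ?g = "\<lambda>i. nprod (- 1 - int j) a (nprod i b u) \<otimes> nprod (q + int j - 1 - i) c v"
      let ?h = "\<lambda>i. nprod i b (nprod (int j) a u) \<otimes> nprod (q - 1 - int j - 1 - i) c v"
      have "Sum_any (g j) = Sum_any (\<lambda>i. ?g (i + int j))"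
        by (rule Sum_any.cong) (simp add: g_def algebra_simps)
      also have "\<dots> = Sum_any ?g" by (rule Sum_any_shift)
      also have "\<dots> = tprod (- 1 - int j) (a \<otimes> vac) (tprod (q + int j) (b \<otimes> c) (u \<otimes> v))"
        by (simp add: tensor_nprod_pair[of "q + int j" b] clinear_Sum_any[OF clinear_tprod finite_tensor_support_0]
            tprod_first_factor)
      finally have 1: "Sum_any (g j) = tprod (- 1 - int j) (a \<otimes> vac) (tprod (q + int j) (b \<otimes> c) (u \<otimes> v))" .
      have "Sum_any (h j) = Sum_any (\<lambda>i. ?h (i + (- 1 - int j)))"
        by (rule Sum_any.cong) (simp add: h_def algebra_simps)
      also have "\<dots> = Sum_any ?h" by (rule Sum_any_shift)
      also have "\<dots> = tprod (q - 1 - int j) (b \<otimes> c) (tprod (int j) (a \<otimes> vac) (u \<otimes> v))"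
        unfolding tprod_first_factor by (simp add: tensor_nprod_pair)
      finally have 2: "Sum_any (h j) = tprod (q - 1 - int j) (b \<otimes> c) (tprod (int j) (a \<otimes> vac) (u \<otimes> v))" .
      show "Sum_any (\<lambda>i. g j i + h j i) =
          tprod (- 1 - int j) (a \<otimes> vac) (tprod (q + int j) (b \<otimes> c) (u \<otimes> v)) +
          tprod (q - 1 - int j) (b \<otimes> c) (tprod (int j) (a \<otimes> vac) (u \<otimes> v))"
        unfolding Sum_any.distrib[OF fing finh] using 1 2 by simp
    qed
    finally show ?thesis .
  qed
  then show ?thesis unfolding eventually_sequentially by blast
qed

lemma first_factor_commutator:
  "\<forall>\<^sub>F M in sequentially.
    tprod m (a \<otimes> vac) (tprod n x w) - tprod n x (tprod m (a \<otimes> vac) w) =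
    (\<Sum>k<M. (of_int m gchoose k) *\<^sub>C tprod (m + n - int k) (tprod (int k) (a \<otimes> vac) x) w)"
proof (induction x rule: tensor_induct)
  case zero
  show ?case by (simp add: tprod_linear)
next
  case (add b c t)
  have "\<forall>\<^sub>F M in sequentially.
    tprod m (a \<otimes> vac) (tprod n (b \<otimes> c) w) - tprod n (b \<otimes> c) (tprod m (a \<otimes> vac) w) =
    (\<Sum>k<M. (of_int m gchoose k) *\<^sub>C tprod (m + n - int k) (tprod (int k) (a \<otimes> vac) (b \<otimes> c)) w)"
  proof (induction w rule: tensor_induct)
    case zero
    show ?case by (simp add: tprod_linear)
  next
    case (add u v s)
    from add first_factor_commutator_pure[of m a n b c u v] show ?case
      by eventually_elim (simp add: tprod_linear sum.distrib scaleC_add_right algebra_simps)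
  qed
  with add show ?case
    by eventually_elim (simp add: tprod_linear sum.distrib scaleC_add_right algebra_simps)
qed

lemma first_factor_associativity:
  "\<forall>\<^sub>F M in sequentially.
    tprod q (tprod (-1) (a \<otimes> vac) x) w =
    (\<Sum>j<M. tprod (- 1 - int j) (a \<otimes> vac) (tprod (q + int j) x w) +
      tprod (q - 1 - int j) x (tprod (int j) (a \<otimes> vac) w))"
proof (induction x rule: tensor_induct)
  case zero
  show ?case by (simp add: tprod_linear)
next
  case (add b c t)
  have "\<forall>\<^sub>F M in sequentially.
    tprod q (tprod (-1) (a \<otimes> vac) (b \<otimes> c)) w =
    (\<Sum>j<M. tprod (- 1 - int j) (a \<otimes> vac) (tprod (q + int j) (b \<otimes> c) w) +
      tprod (q - 1 - int j) (b \<otimes> c) (tprod (int j) (a \<otimes> vac) w))"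
  proof (induction w rule: tensor_induct)
    case zero
    show ?case by (simp add: tprod_linear)
  next
    case (add u v s)
    from add first_factor_associativity_pure[of q a b c u v] show ?case
      by eventually_elim (simp add: tprod_linear sum.distrib algebra_simps)
  qed
  with add show ?case
    by eventually_elim (simp add: tprod_linear sum.distrib algebra_simps)
qed

lemma eta_commutator:
  "\<forall>\<^sub>F M in sequentially.
    tprod m (eta vac a) (tprod n x w) - tprod n x (tprod m (eta vac a) w) =
    (\<Sum>k<M. (of_int m gchoose k) *\<^sub>C tprod (m + n - int k) (tprod (int k) (eta vac a) x) w)"
proof -
  from first_factor_commutator[of m a n "tensor_swap x" "tensor_swap w"]
  have "\<forall>\<^sub>F M in sequentially.
    tprod m (vac \<otimes> a) (tprod n x w) - tprod n x (tprod m (vac \<otimes> a) w) =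
    (\<Sum>k<M. (of_int m gchoose k) *\<^sub>C tprod (m + n - int k) (tprod (int k) (vac \<otimes> a) x) w)"
    by eventually_elim (drule arg_cong[where f = tensor_swap], simp add: tensor_swap_tprod
        tensor_swap_swap tensor_swap_pair clinear_sum[OF clinear_tensor_swap]
        clinear_scale[OF clinear_tensor_swap] clinear_diff[OF clinear_tensor_swap])
  with first_factor_commutator[of m a n x w] show ?thesis
    by eventually_elim (simp add: eta_def tprod_linear sum.distrib scaleC_add_right algebra_simps)
qed

lemma eta_associativity:
  "\<forall>\<^sub>F M in sequentially.
    tprod q (tprod (-1) (eta vac a) x) w =
    (\<Sum>j<M. tprod (- 1 - int j) (eta vac a) (tprod (q + int j) x w) +
      tprod (q - 1 - int j) x (tprod (int j) (eta vac a) w))"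
proof -
  from first_factor_associativity[of q a "tensor_swap x" "tensor_swap w"]
  have "\<forall>\<^sub>F M in sequentially.
    tprod q (tprod (-1) (vac \<otimes> a) x) w =
    (\<Sum>j<M. tprod (- 1 - int j) (vac \<otimes> a) (tprod (q + int j) x w) +
      tprod (q - 1 - int j) x (tprod (int j) (vac \<otimes> a) w))"
    by eventually_elim (drule arg_cong[where f = tensor_swap], simp add: tensor_swap_tprod
        tensor_swap_swap tensor_swap_pair clinear_sum[OF clinear_tensor_swap]
        clinear_add[OF clinear_tensor_swap])
  with first_factor_associativity[of q a x w] show ?thesis
    by eventually_elim (simp add: eta_def tprod_linear sum.distrib algebra_simps)
qed

text \<open>
  The \<open>0\<close>-th product by \<open>\<eta>(conf)\<close> is the translation operator on the tensor square. The factors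
  \<open>-(i + 1)\<close> and \<open>-(n - 1 - i)\<close> that come from the two tensor factors add up to \<open>-n\<close>.
\<close>

lemma tprod_translation:
  "tprod n (tprod 0 (eta vac conf) x) w = - (of_int n *\<^sub>C tprod (n - 1) x w)"
proof (induction x rule: tensor_induct)
  case zero
  show ?case by (simp add: tprod_linear)
next
  case (add a b t)
  have "tprod n (tprod 0 (eta vac conf) (a \<otimes> b)) w = - (of_int n *\<^sub>C tprod (n - 1) (a \<otimes> b) w)"
  proof (induction w rule: tensor_induct)
    case zero
    show ?case by (simp add: tprod_linear)
  next
    case (add u v s)
    let ?h = "\<lambda>i. nprod i a u \<otimes> nprod (n - 1 - 1 - i) b v"
    have scale: "clinear (\<lambda>x::('a, 'a) tensor. c *\<^sub>C x)" for c
      by (rule clinearI) (simp_all add: scaleC_add_right scaleC_scaleC mult.commute)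
    have fin: "finite {i. ?h i \<noteq> 0}" by (rule finite_tensor_support_0)
    have fin': "finite {i. c i *\<^sub>C ?h i \<noteq> 0}" for c
      by (rule finite_subset[OF _ fin]) auto
    have neg1: "(- x) \<otimes> y = (- 1) *\<^sub>C (x \<otimes> y)" and neg2: "x \<otimes> (- y) = (- 1) *\<^sub>C (x \<otimes> y)" for x y :: 'a
      using clinear_scale[OF clinear_tensor_pair_left, of "-1" x y] clinear_scale[OF clinear_tensor_pair, of x "-1" y]
      by (simp_all add: scaleC_one)
    have "tprod n (nprod 0 conf a \<otimes> b) (u \<otimes> v) = Sum_any (\<lambda>i. of_int (- i) *\<^sub>C (nprod (i - 1) a u \<otimes> nprod (n - 1 - i) b v))"
      unfolding tensor_nprod_pair
      by (rule Sum_any.cong) (simp add: translation neg1 tensor_pair_linear scaleC_scaleC)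
    also have "\<dots> = Sum_any (\<lambda>i. of_int (- ((i + (- 1)) + 1)) *\<^sub>C ?h (i + (- 1)))"
      by (rule Sum_any.cong) (simp add: algebra_simps)
    also have "\<dots> = Sum_any (\<lambda>i. of_int (- (i + 1)) *\<^sub>C ?h i)"
      by (rule Sum_any_shift[where f = "\<lambda>i. of_int (- (i + 1)) *\<^sub>C ?h i"])
    finally have 1: "tprod n (nprod 0 conf a \<otimes> b) (u \<otimes> v) = Sum_any (\<lambda>i. of_int (- (i + 1)) *\<^sub>C ?h i)" .
    have 2: "tprod n (a \<otimes> nprod 0 conf b) (u \<otimes> v) = Sum_any (\<lambda>i. of_int (- (n - 1 - i)) *\<^sub>C ?h i)"
      unfolding tensor_nprod_pair
      by (rule Sum_any.cong) (simp add: translation neg2 tensor_pair_linear scaleC_scaleC algebra_simps)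
    have "tprod n (tprod 0 (eta vac conf) (a \<otimes> b)) (u \<otimes> v) =
        Sum_any (\<lambda>i. of_int (- (i + 1)) *\<^sub>C ?h i + of_int (- (n - 1 - i)) *\<^sub>C ?h i)"
      unfolding tprod_eta clinear_add[OF clinear_tprod_left] 1 2
      by (rule Sum_any.distrib[OF fin' fin', symmetric])
    also have "\<dots> = Sum_any (\<lambda>i. of_int (- n) *\<^sub>C ?h i)"
      by (rule Sum_any.cong) (simp add: scaleC_add_left[symmetric])
    also have "\<dots> = of_int (- n) *\<^sub>C Sum_any ?h"
      by (rule clinear_Sum_any[OF scale fin, symmetric])
    also have "Sum_any ?h = tprod (n - 1) (a \<otimes> b) (u \<otimes> v)"
      by (simp add: tensor_nprod_pair)
    finally show ?case using add by (simp add: tprod_linear scaleC_add_right)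
  qed
  with add show ?case by (simp add: tprod_linear scaleC_add_right)
qed

end

section \<open>The commutative algebra of the fixed points modulo C2\<close>

definition sym_tensor :: "'a::complex_vector \<Rightarrow> 'a \<Rightarrow> ('a, 'a) tensor"
  where "sym_tensor a b = a \<otimes> b + b \<otimes> a"

lemma sym_tensor_commute: "sym_tensor a b = sym_tensor b a"
  by (simp add: sym_tensor_def add.commute)

text \<open>
  A fixed tensor is the average of itself and its swap.
\<close>

lemma swap_fixed_spanned_by_sym_tensors: "swap_fixed \<subseteq> cspan {sym_tensor a b | a b. True}"
proof
  fix w :: "('a, 'a) tensor" assume "w \<in> swap_fixed"
  then have w: "tensor_swap w = w" by (simp add: swap_fixed_def)
  have "t + tensor_swap t \<in> cspan {sym_tensor a b | a b. True}" for t :: "('a, 'a) tensor"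
  proof (induction t rule: tensor_induct)
    case zero
    show ?case by (simp add: clinear_0[OF clinear_tensor_swap] complex_vector.span_zero)
  next
    case (add a b t)
    have eq: "a \<otimes> b + t + tensor_swap (a \<otimes> b + t) = sym_tensor a b + (t + tensor_swap t)"
      by (simp add: sym_tensor_def clinear_add[OF clinear_tensor_swap] tensor_swap_pair)
    show ?case
      unfolding eq using add by (auto intro: complex_vector.span_add complex_vector.span_base)
  qed
  from this[of w] have "(1 / 2) *\<^sub>C (w + w) \<in> cspan {sym_tensor a b | a b. True}"
    unfolding w by (rule complex_vector.span_scale)
  moreover have "(1 / 2) *\<^sub>C (w + w) = w"
    by (simp add: scaleC_add_right scaleC_add_left[symmetric] scaleC_one)
  ultimately show "w \<in> cspan {sym_tensor a b | a b. True}" by simp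
qed

lemma clinear_eta: "clinear (eta vac)"
  by (rule clinearI) (simp_all add: eta_def tensor_pair_linear scaleC_add_right)

context vertex_operator_algebra
begin

abbreviation fixC2 :: "('a, 'a) tensor set"
  where "fixC2 \<equiv> C2 tprod swap_fixed"

abbreviation tvac :: "('a, 'a) tensor"
  where "tvac \<equiv> vac \<otimes> vac"

lemma tvac_in_swap_fixed: "tvac \<in> swap_fixed"
  by (simp add: swap_fixed_def tensor_swap_pair)

lemma eta_times_eta: "tprod (-1) (eta vac a) (eta vac b) = eta vac (nprod (-1) a b) + sym_tensor a b"
  by (simp add: eta_def[of vac b] eta_def[of vac "nprod (-1) a b"] sym_tensor_def clinear_add[OF clinear_tprod] tprod_eta creation)

lemma eta_times_sym_tensor:
  "tprod (-1) (eta vac a) (sym_tensor b c) =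
    sym_tensor (nprod (-1) a b) c + sym_tensor b (nprod (-1) a c)"
  by (simp add: sym_tensor_def clinear_add[OF clinear_tprod] tprod_eta algebra_simps)

lemma eta_nprod_vac: "eta vac (nprod n a vac) = tprod n (eta vac a) tvac"
  by (simp add: tprod_eta) (simp add: eta_def)

lemma tprod_tvac_right: "tprod (-1) x tvac = x"
proof (rule tensor_linear_eqI[of "\<lambda>x. tprod (-1) x tvac" "\<lambda>x. x"])
  fix a b
  have "tprod (-1) (a \<otimes> b) tvac = nprod (-1) a vac \<otimes> nprod (- 1 - 1 - (- 1)) b vac"
    unfolding tensor_nprod_pair
  proof (rule Sum_any_eq_single)
    fix i :: int assume "i \<noteq> - 1"
    then have "i \<ge> 0 \<or> - 1 - 1 - i \<ge> 0" by linarith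
    then show "nprod i a vac \<otimes> nprod (- 1 - 1 - i) b vac = 0"
      by (auto simp: creation_regular tensor_pair_linear)
  qed
  then show "tprod (-1) (a \<otimes> b) tvac = a \<otimes> b" by (simp add: creation)
qed (rule clinear_tprod_left, rule clinearI, auto)

lemma tprod_tvac_left: "tprod (-1) tvac w = w"
proof (rule tensor_linear_eqI[of "\<lambda>w. tprod (-1) tvac w" "\<lambda>x. x"])
  show "tprod (-1) tvac (u \<otimes> v) = u \<otimes> v" for u v
    using tprod_first_factor[of "-1" vac u v] by (simp add: vacuum_left)
qed (rule clinear_tprod, rule clinearI, auto)

lemmas fixC2_add = complex_vector.subspace_add[OF csubspace_C2]
  and fixC2_scale = complex_vector.subspace_scale[OF csubspace_C2]

lemma fixC2_subset: "fixC2 \<subseteq> swap_fixed"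
  unfolding C2_def by (rule complex_vector.span_minimal)
    (auto simp: csubspace_swap_fixed tprod_swap_fixed)

text \<open>
  By translation, the \<open>(n - 1)\<close>-st product is up to a nonzero factor an \<open>n\<close>-th product, if \<open>n \<noteq> 0\<close>.
\<close>

lemma tprod_below_in_fixC2:
  assumes "x \<in> swap_fixed" "w \<in> swap_fixed" "n \<le> -2"
  shows "tprod n x w \<in> fixC2"
proof -
  have "tprod (- 2 - int k) x w \<in> fixC2" if "x \<in> swap_fixed" for k x
    using that
  proof (induction k arbitrary: x)
    case 0
    then show ?case using assms(2) unfolding C2_def by (auto intro: complex_vector.span_base)
  next
    case (Suc k)
    let ?D = "tprod 0 (eta vac conf) x"
    have "tprod (- 2 - int k) ?D w \<in> fixC2"
      using Suc by (simp add: tprod_swap_fixed eta_in_swap_fixed)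
    then have "(1 / of_nat (k + 2)) *\<^sub>C tprod (- 2 - int k) ?D w \<in> fixC2"
      by (rule fixC2_scale)
    also have "tprod (- 2 - int k) ?D w = of_nat (k + 2) *\<^sub>C tprod (- 2 - int (Suc k)) x w"
    proof -
      have "of_nat (k + 2) = - (of_int (- 2 - int k) :: complex)" by simp
      moreover have "- 2 - int (Suc k) = - 2 - int k - 1" by simp
      ultimately show ?thesis
        by (simp only: tprod_translation complex_vector.scale_minus_left)
    qed
    also have "(1 / of_nat (k + 2)) *\<^sub>C \<dots> = tprod (- 2 - int (Suc k)) x w"
      using of_nat_eq_0_iff[of "k + 2", where 'a = complex]
      by (simp add: scaleC_scaleC scaleC_one del: of_nat_add)
    finally show ?case .
  qed
  from this[OF assms(1), of "nat (- 2 - n)"] assms(3) show ?thesis by simp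
qed

text \<open>
  Equality in the quotient \<open>R\<close> of the fixed points by \<open>C2\<close>.
\<close>

definition cong_fixC2 :: "('a, 'a) tensor \<Rightarrow> ('a, 'a) tensor \<Rightarrow> bool"  (infix \<open>\<simeq>\<close> 50)
  where "x \<simeq> y \<longleftrightarrow> x - y \<in> fixC2"

lemma cong_refl [simp]: "x \<simeq> x"
  by (simp add: cong_fixC2_def complex_vector.subspace_0[OF csubspace_C2])

lemma cong_sym: "x \<simeq> y \<Longrightarrow> y \<simeq> x"
  unfolding cong_fixC2_def using complex_vector.subspace_neg[OF csubspace_C2, of "x - y"] by simp

lemma cong_trans [trans]: "x \<simeq> y \<Longrightarrow> y \<simeq> z \<Longrightarrow> x \<simeq> z"
  unfolding cong_fixC2_def using fixC2_add[of "x - y" _ _ "y - z"] by simp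

lemma cong_in_subspace:
  assumes "x \<simeq> y" "y \<in> S" "csubspace S" "fixC2 \<subseteq> S"
  shows "x \<in> S"
  using complex_vector.subspace_add[OF assms(3), of "x - y" y] assms by (auto simp: cong_fixC2_def)

text \<open>
  All terms on the right of the commutator formula have an outer index below \<open>-1\<close>.
\<close>

lemma eta_commute_product:
  assumes "x \<in> swap_fixed" "w \<in> swap_fixed" "n \<le> -1"
  shows "tprod (-1) (eta vac a) (tprod n x w) \<simeq> tprod n x (tprod (-1) (eta vac a) w)"
proof -
  obtain M where "tprod (-1) (eta vac a) (tprod n x w) - tprod n x (tprod (-1) (eta vac a) w) =
    (\<Sum>k<M. (of_int (-1) gchoose k) *\<^sub>C tprod (- 1 + n - int k) (tprod (int k) (eta vac a) x) w)"
    using eventually_happens'[OF sequentially_bot eta_commutator] by blast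
  moreover have "tprod (- 1 + n - int k) (tprod (int k) (eta vac a) x) w \<in> fixC2" for k
    using assms by (intro tprod_below_in_fixC2 tprod_swap_fixed eta_in_swap_fixed) auto
  ultimately show ?thesis
    unfolding cong_fixC2_def
    by (simp only:) (intro complex_vector.subspace_sum csubspace_C2 fixC2_scale)
qed

text \<open>
  Of the associativity formula only one term, the first one for \<open>j = 0\<close>, has an outer index above \<open>-2\<close>.
\<close>

lemma eta_associative:
  assumes "x \<in> swap_fixed" "w \<in> swap_fixed"
  shows "tprod (-1) (tprod (-1) (eta vac a) x) w \<simeq> tprod (-1) (eta vac a) (tprod (-1) x w)"
proof -
  define f where "f j = tprod (- 1 - int j) (eta vac a) (tprod (- 1 + int j) x w) +
      tprod (- 1 - 1 - int j) x (tprod (int j) (eta vac a) w)" for j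
  have "\<forall>\<^sub>F M in sequentially. tprod (-1) (tprod (-1) (eta vac a) x) w = sum f {..<M} \<and> 0 < M"
    unfolding f_def by (intro eventually_conj eta_associativity eventually_gt_at_top)
  then obtain M where M: "tprod (-1) (tprod (-1) (eta vac a) x) w = sum f {..<M}" "0 < M"
    using eventually_happens'[OF sequentially_bot] by blast
  then have "sum f {..<M} = f 0 + sum f ({..<M} - {0})"
    by (intro sum.remove) auto
  then have "tprod (-1) (tprod (-1) (eta vac a) x) w - tprod (-1) (eta vac a) (tprod (-1) x w) =
      tprod (-2) x (tprod 0 (eta vac a) w) + sum f ({..<M} - {0})"
    unfolding M(1) by (simp add: f_def)
  also have "\<dots> \<in> fixC2"
    using assms unfolding f_def
    by (intro fixC2_add complex_vector.subspace_sum csubspace_C2 tprod_below_in_fixC2 tprod_swap_fixed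
        eta_in_swap_fixed) auto
  finally show ?thesis unfolding cong_fixC2_def .
qed

lemma eta_times_fixC2:
  assumes "z \<in> fixC2"
  shows "tprod (-1) (eta vac a) z \<in> fixC2"
  using assms unfolding C2_def
proof (induction rule: complex_vector.span_induct_alt)
  case base
  show ?case by (simp add: tprod_linear complex_vector.span_zero)
next
  case (step c z y)
  then obtain u v where uv: "z = tprod (-2) u v" "u \<in> swap_fixed" "v \<in> swap_fixed" by blast
  have "tprod (-2) u (tprod (-1) (eta vac a) v) \<in> fixC2"
    using uv by (intro tprod_below_in_fixC2 tprod_swap_fixed eta_in_swap_fixed) auto
  from cong_in_subspace[OF eta_commute_product[OF uv(2,3)] this csubspace_C2 order_refl]
  have "tprod (-1) (eta vac a) z \<in> fixC2" unfolding uv(1) by simp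
  with step show ?case
    unfolding C2_def by (simp add: tprod_linear complex_vector.span_add complex_vector.span_scale)
qed

lemma eta_times_cong: "x \<simeq> y \<Longrightarrow> tprod (-1) (eta vac a) x \<simeq> tprod (-1) (eta vac a) y"
  using eta_times_fixC2 by (simp add: cong_fixC2_def tprod_linear(3)[symmetric])

text \<open>
  This reduces statements about arbitrary fixed points to the operators \<open>\<eta>(a)\<close>, for which the commutator
  and associativity formulas are available.
\<close>

lemma swap_fixed_induct [consumes 1, case_names eta eta_eta add scale]:
  assumes "w \<in> swap_fixed"
    and "\<And>a. P (eta vac a)"
    and "\<And>a b. P (tprod (-1) (eta vac a) (eta vac b))"
    and "\<And>x y. P x \<Longrightarrow> P y \<Longrightarrow> P (x + y)"
    and "\<And>c x. P x \<Longrightarrow> P (c *\<^sub>C x)"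
  shows "P w"
proof -
  from assms(1) have "w \<in> cspan {sym_tensor a b | a b. True}"
    using swap_fixed_spanned_by_sym_tensors by blast
  then show ?thesis
  proof (induction rule: complex_vector.span_induct_alt)
    case base
    show ?case using assms(5)[OF assms(2)[of 0], of 0] by simp
  next
    case (step c x y)
    then obtain a b where x: "x = sym_tensor a b" by blast
    have "x = tprod (-1) (eta vac a) (eta vac b) + (-1) *\<^sub>C eta vac (nprod (-1) a b)"
      by (simp add: x eta_times_eta scaleC_one)
    then have "P x" using assms by metis
    with step assms show ?case by blast
  qed
qed

lemma swap_fixed_times_fixC2:
  assumes "w \<in> swap_fixed" "z \<in> fixC2"
  shows "tprod (-1) w z \<in> fixC2"
  using assms(1)
proof (induction rule: swap_fixed_induct)
  case (eta a)
  show ?case by (rule eta_times_fixC2[OF assms(2)])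
next
  case (eta_eta a b)
  have "tprod (-1) (tprod (-1) (eta vac a) (eta vac b)) z \<simeq> tprod (-1) (eta vac a) (tprod (-1) (eta vac b) z)"
    using assms(2) fixC2_subset by (intro eta_associative eta_in_swap_fixed) auto
  moreover have "tprod (-1) (eta vac a) (tprod (-1) (eta vac b) z) \<in> fixC2"
    by (intro eta_times_fixC2 assms)
  ultimately show ?case by (rule cong_in_subspace) (auto simp: csubspace_C2)
next
  case (add x y)
  then show ?case by (simp add: tprod_linear fixC2_add)
next
  case (scale c x)
  then show ?case by (simp add: tprod_linear fixC2_scale)
qed

lemma swap_fixed_commutative:
  assumes "u \<in> swap_fixed" "w \<in> swap_fixed"
  shows "tprod (-1) u w \<simeq> tprod (-1) w u"
proof -
  have eta_comm: "tprod (-1) (eta vac a) w \<simeq> tprod (-1) w (eta vac a)" if "w \<in> swap_fixed" for a w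
    using eta_commute_product[OF that tvac_in_swap_fixed, of "-1" a] by (simp add: tprod_tvac_right)
  from assms(1) show ?thesis
  proof (induction rule: swap_fixed_induct)
    case (eta a)
    show ?case by (rule eta_comm[OF assms(2)])
  next
    case (eta_eta a b)
    have "tprod (-1) (tprod (-1) (eta vac a) (eta vac b)) w \<simeq> tprod (-1) (eta vac a) (tprod (-1) (eta vac b) w)"
      using assms(2) by (intro eta_associative eta_in_swap_fixed)
    also have "\<dots> \<simeq> tprod (-1) (eta vac a) (tprod (-1) w (eta vac b))"
      by (intro eta_times_cong eta_comm[OF assms(2)])
    also have "\<dots> \<simeq> tprod (-1) w (tprod (-1) (eta vac a) (eta vac b))"
      using assms(2) by (intro eta_commute_product eta_in_swap_fixed) auto
    finally show ?case .
  next
    case (add x y)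
    then have "tprod (-1) x w - tprod (-1) w x + (tprod (-1) y w - tprod (-1) w y) \<in> fixC2"
      unfolding cong_fixC2_def by (rule fixC2_add)
    then show ?case by (simp add: cong_fixC2_def tprod_linear algebra_simps)
  next
    case (scale c x)
    then have "c *\<^sub>C (tprod (-1) x w - tprod (-1) w x) \<in> fixC2"
      unfolding cong_fixC2_def by (rule fixC2_scale)
    then show ?case by (simp add: cong_fixC2_def tprod_linear complex_vector.scale_right_diff_distrib)
  qed
qed

lemma fixC2_times_swap_fixed:
  assumes "z \<in> fixC2" "w \<in> swap_fixed"
  shows "tprod (-1) z w \<in> fixC2"
proof (rule cong_in_subspace[OF _ swap_fixed_times_fixC2[OF assms(2,1)]])
  show "tprod (-1) z w \<simeq> tprod (-1) w z"
    using assms fixC2_subset by (intro swap_fixed_commutative) auto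
qed (auto simp: csubspace_C2)

text \<open>
  The second component of a letter is the degree assigned to the first one, which \<open>etaFil\<close> below adds up.
\<close>

definition etaprod :: "('a \<times> nat) list \<Rightarrow> ('a, 'a) tensor"
  where "etaprod xs = foldr (\<lambda>g v. tprod (-1) (eta vac (fst g)) v) xs tvac"

lemma etaprod_simps [simp]:
  "etaprod [] = tvac" "etaprod (g # xs) = tprod (-1) (eta vac (fst g)) (etaprod xs)"
  by (simp_all add: etaprod_def)

lemma etaprod_in_swap_fixed: "etaprod xs \<in> swap_fixed"
  by (induction xs) (auto simp: tvac_in_swap_fixed tprod_swap_fixed eta_in_swap_fixed)

lemma etaprod_append: "etaprod (xs @ ys) \<simeq> tprod (-1) (etaprod xs) (etaprod ys)"
proof (induction xs)
  case Nil
  show ?case by (simp add: tprod_tvac_left)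
next
  case (Cons g xs)
  have "etaprod ((g # xs) @ ys) \<simeq> tprod (-1) (eta vac (fst g)) (tprod (-1) (etaprod xs) (etaprod ys))"
    using eta_times_cong[OF Cons] by simp
  also have "\<dots> \<simeq> tprod (-1) (etaprod (g # xs)) (etaprod ys)"
    using cong_sym[OF eta_associative[OF etaprod_in_swap_fixed etaprod_in_swap_fixed]] by simp
  finally show ?case .
qed

lemma etaprod_move: "etaprod (h # replicate k g @ zs) \<simeq> etaprod (replicate k g @ h # zs)"
proof (induction k)
  case 0
  show ?case by simp
next
  case (Suc k)
  have "etaprod (h # replicate (Suc k) g @ zs) \<simeq> etaprod (g # h # replicate k g @ zs)"
    using eta_commute_product[OF eta_in_swap_fixed etaprod_in_swap_fixed, of "-1"] by simp
  also have "\<dots> \<simeq> etaprod (replicate (Suc k) g @ h # zs)"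
    using eta_times_cong[OF Suc] by simp
  finally show ?case .
qed

text \<open>
  In \<open>R\<close>, all occurrences of a letter can be moved to the front.
\<close>

lemma etaprod_collect:
  "etaprod xs \<simeq> etaprod (filter ((=) g) xs @ filter ((\<noteq>) g) xs)"
proof (induction xs)
  case Nil
  show ?case by simp
next
  case (Cons h xs)
  have *: "etaprod (h # xs) \<simeq> etaprod (h # filter ((=) g) xs @ filter ((\<noteq>) g) xs)"
    using eta_times_cong[OF Cons] by simp
  show ?case
  proof (cases "g = h")
    case True
    with * show ?thesis by simp
  next
    case False
    have "etaprod (h # filter ((=) g) xs @ filter ((\<noteq>) g) xs) \<simeq> etaprod (filter ((=) g) xs @ h # filter ((\<noteq>) g) xs)"
      using etaprod_move[of h "length (filter ((=) g) xs)" g] by (simp add: replicate_length_filter)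
    from cong_trans[OF * this] False show ?thesis by simp
  qed
qed

text \<open>
  For a set \<open>G\<close> of vectors with assigned degrees, \<open>etaFil G m\<close> consists of the representatives of those
  elements of \<open>R\<close> that are polynomials of weighted degree at most \<open>m\<close> in the \<open>\<eta>(a)\<close>, \<open>a\<close> in \<open>G\<close>.
\<close>

definition etaFil :: "('a \<times> nat) set \<Rightarrow> int \<Rightarrow> ('a, 'a) tensor set"
  where "etaFil G m = cspan (fixC2 \<union> {etaprod xs | xs. set xs \<subseteq> G \<and> int (sum_list (map snd xs)) \<le> m})"

lemma csubspace_etaFil [simp]: "csubspace (etaFil G m)"
  by (simp add: etaFil_def)

lemmas etaFil_add = complex_vector.subspace_add[OF csubspace_etaFil]
  and etaFil_diff = complex_vector.subspace_diff[OF csubspace_etaFil]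
  and etaFil_scale = complex_vector.subspace_scale[OF csubspace_etaFil]
  and etaFil_0 = complex_vector.subspace_0[OF csubspace_etaFil]

lemma fixC2_subset_etaFil: "fixC2 \<subseteq> etaFil G m"
  unfolding etaFil_def by (rule order_trans[OF _ complex_vector.span_superset]) simp

lemma etaFil_mono: "m \<le> n \<Longrightarrow> etaFil G m \<subseteq> etaFil G n"
  unfolding etaFil_def by (rule complex_vector.span_mono) auto

lemma etaprod_in_etaFil:
  "set xs \<subseteq> G \<Longrightarrow> int (sum_list (map snd xs)) \<le> m \<Longrightarrow> etaprod xs \<in> etaFil G m"
  unfolding etaFil_def by (rule complex_vector.span_base) blast

lemma eta_in_etaFil: "(a, d) \<in> G \<Longrightarrow> int d \<le> m \<Longrightarrow> eta vac a \<in> etaFil G m"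
  using etaprod_in_etaFil[of "[(a, d)]" G m] by (simp add: tprod_tvac_right)

lemma etaFil_subset_swap_fixed: "etaFil G m \<subseteq> swap_fixed"
  unfolding etaFil_def using fixC2_subset etaprod_in_swap_fixed
  by (intro complex_vector.span_minimal csubspace_swap_fixed) auto

lemma tprod_etaFil:
  assumes "u \<in> etaFil G p" "w \<in> etaFil G q"
  shows "tprod (-1) u w \<in> etaFil G (p + q)"
  using assms(1) unfolding etaFil_def[of G p]
proof (induction rule: complex_vector.span_induct_alt)
  case base
  show ?case by (simp add: tprod_linear etaFil_0)
next
  case (step c u v)
  have "tprod (-1) u w \<in> etaFil G (p + q)"
  proof (cases "u \<in> fixC2")
    case True
    have "w \<in> swap_fixed" using assms(2) etaFil_subset_swap_fixed by auto
    from fixC2_times_swap_fixed[OF True this] show ?thesis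
      by (rule subsetD[OF fixC2_subset_etaFil])
  next
    case False
    with step obtain xs where xs: "u = etaprod xs" "set xs \<subseteq> G" "int (sum_list (map snd xs)) \<le> p"
      by blast
    from assms(2) show ?thesis unfolding etaFil_def[of G q]
    proof (induction rule: complex_vector.span_induct_alt)
      case base
      show ?case by (simp add: tprod_linear etaFil_0)
    next
      case (step c w v)
      have "tprod (-1) u w \<in> etaFil G (p + q)"
      proof (cases "w \<in> fixC2")
        case True
        from swap_fixed_times_fixC2[OF etaprod_in_swap_fixed True] show ?thesis
          unfolding xs(1) by (rule subsetD[OF fixC2_subset_etaFil])
      next
        case False
        with step obtain ys where ys: "w = etaprod ys" "set ys \<subseteq> G" "int (sum_list (map snd ys)) \<le> q"
          by blast
        have "etaprod (xs @ ys) \<in> etaFil G (p + q)"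
          using xs ys by (intro etaprod_in_etaFil) auto
        from cong_in_subspace[OF cong_sym[OF etaprod_append] this csubspace_etaFil fixC2_subset_etaFil]
        show ?thesis by (simp add: xs ys)
      qed
      with step show ?case by (simp add: tprod_linear etaFil_add etaFil_scale)
    qed
  qed
  with step show ?case by (simp add: tprod_linear etaFil_add etaFil_scale)
qed

text \<open>
  A product with more than \<open>card G * K\<close> factors contains some letter at least \<open>K\<close> times. Collecting these
  and replacing the power by terms of smaller degree, induction on the degree applies.
\<close>

lemma etaFil_finite_modulo_C2:
  assumes G: "finite G"
    and nil: "\<And>a d. (a, d) \<in> G \<Longrightarrow> etaprod (replicate K (a, d)) \<in> etaFil G (int (K * d) - 1)"
  shows "etaFil G m \<subseteq> cspan (fixC2 \<union> etaprod ` {xs. set xs \<subseteq> G \<and> length xs \<le> card G * K})"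
    (is "_ \<subseteq> ?Z")
proof -
  have mono: "etaprod xs \<in> ?Z" if "set xs \<subseteq> G" for xs
    using that
  proof (induction "sum_list (map snd xs)" arbitrary: xs rule: less_induct)
    case less
    show ?case
    proof (cases "length xs \<le> card G * K")
      case True
      then show ?thesis using less.prems by (intro complex_vector.span_base) auto
    next
      case False
      have "\<exists>g\<in>G. count_list xs g \<ge> K"
      proof (rule ccontr)
        assume "\<not> (\<exists>g\<in>G. count_list xs g \<ge> K)"
        then have "sum (count_list xs) G \<le> (\<Sum>g\<in>G. K)" by (intro sum_mono) auto
        with False show False by (simp add: sum_count_set[OF less.prems G])
      qed
      then obtain a d where g: "(a, d) \<in> G" "count_list xs (a, d) \<ge> K" by auto
      let ?g = "(a, d)"
      define ys where "ys = replicate (count_list xs ?g - K) ?g @ filter ((\<noteq>) ?g) xs"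
      have "filter ((=) ?g) xs = replicate (count_list xs ?g) ?g"
        by (simp add: count_list_eq_length_filter replicate_length_filter)
      also have "\<dots> = replicate K ?g @ replicate (count_list xs ?g - K) ?g"
        using g(2) by (simp add: replicate_add[symmetric])
      finally have split: "filter ((=) ?g) xs @ filter ((\<noteq>) ?g) xs = replicate K ?g @ ys"
        by (simp add: ys_def)
      have "sum_list (map snd (filter ((=) ?g) zs @ filter ((\<noteq>) ?g) zs)) = sum_list (map snd zs)" for zs
        by (induction zs) auto
      from this[of xs] have deg: "sum_list (map snd xs) = K * d + sum_list (map snd ys)"
        unfolding split by (simp add: sum_list_replicate)
      have ys: "set ys \<subseteq> G" using less.prems g(1) by (auto simp: ys_def)
      have "etaprod xs \<simeq> tprod (-1) (etaprod (replicate K ?g)) (etaprod ys)"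
        using cong_trans[OF etaprod_collect[of xs ?g] etaprod_append[of "replicate K ?g" ys, folded split]] .
      moreover have "tprod (-1) (etaprod (replicate K ?g)) (etaprod ys)
          \<in> etaFil G (int (sum_list (map snd xs)) - 1)"
        using tprod_etaFil[OF nil[OF g(1)] etaprod_in_etaFil[OF ys order_refl]]
        unfolding deg by (simp add: algebra_simps)
      ultimately have "etaprod xs \<in> etaFil G (int (sum_list (map snd xs)) - 1)"
        by (rule cong_in_subspace[OF _ _ csubspace_etaFil fixC2_subset_etaFil])
      moreover have "etaFil G (int (sum_list (map snd xs)) - 1) \<subseteq> ?Z"
        unfolding etaFil_def
      proof (rule complex_vector.span_minimal)
        show "fixC2 \<union> {etaprod xsa |xsa. set xsa \<subseteq> G \<and>
            int (sum_list (map snd xsa)) \<le> int (sum_list (map snd xs)) - 1} \<subseteq> ?Z"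
          using less.hyps by (auto intro: complex_vector.span_base)
      qed simp
      ultimately show ?thesis by blast
    qed
  qed
  show ?thesis
    unfolding etaFil_def using mono
    by (intro complex_vector.span_minimal) (auto intro: complex_vector.span_base)
qed

end

section \<open>Generators and their nilpotency\<close>

context strongly_generated_voa
begin

lemma nth_power_beyond:
  assumes "a \<in> Fil d" "nth_power a k \<in> Fil (int k * d - 1)" "i \<ge> k"
  shows "nth_power a i \<in> Fil (int i * d - 1)"
proof -
  have "nth_power a i = (nprod (-1) a ^^ (i - k)) (nth_power a k)"
    unfolding nth_power_def using assms(3) by (simp add: funpow_add[symmetric, THEN fun_cong, unfolded o_def])
  also have "\<dots> \<in> Fil (int (i - k) * d + (int k * d - 1))"
    by (rule funpow_in_Fil[OF assms(1,2)])
  also have "int (i - k) * d + (int k * d - 1) = int i * d - 1"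
    using assms(3) by (simp add: of_nat_diff algebra_simps)
  finally show ?thesis .
qed

text \<open>
  The binomial theorem for \<open>\<eta>(a) = a \<otimes> vac + vac \<otimes> a\<close>, without the coefficients.
\<close>

lemma etaprod_replicate_in_span:
  "etaprod (replicate n (a, d)) \<in> cspan {sym_tensor (nth_power a i) (nth_power a j) | i j. i + j = n}"
proof (induction n)
  case 0
  have "etaprod (replicate 0 (a, d)) = (1 / 2) *\<^sub>C sym_tensor (nth_power a 0) (nth_power a 0)"
    by (simp add: sym_tensor_def scaleC_add_right scaleC_add_left[symmetric] scaleC_one)
  then show ?case
    by (auto intro!: complex_vector.span_scale intro: complex_vector.span_base)
next
  case (Suc n)
  let ?S = "\<lambda>n. {sym_tensor (nth_power a i) (nth_power a j) | i j. i + j = n}"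
  have "tprod (-1) (eta vac a) x \<in> cspan (?S (Suc n))" if "x \<in> cspan (?S n)" for x
    using that
  proof (induction rule: complex_vector.span_induct_alt)
    case base
    show ?case by (simp add: tprod_linear complex_vector.span_zero)
  next
    case (step c x y)
    then obtain i j where x: "x = sym_tensor (nth_power a i) (nth_power a j)" "i + j = n" by blast
    have "sym_tensor (nth_power a (Suc i)) (nth_power a j) \<in> ?S (Suc n)"
      using x(2) by (intro CollectI exI[of _ "Suc i"] exI[of _ j]) simp
    moreover have "sym_tensor (nth_power a i) (nth_power a (Suc j)) \<in> ?S (Suc n)"
      using x(2) by (intro CollectI exI[of _ i] exI[of _ "Suc j"]) simp
    ultimately have "tprod (-1) (eta vac a) x \<in> cspan (?S (Suc n))"
      unfolding x(1) eta_times_sym_tensor nth_power_simps(2)[symmetric]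
      by (intro complex_vector.span_add complex_vector.span_base)
    with step show ?case
      by (simp add: tprod_linear complex_vector.span_add complex_vector.span_scale)
  qed
  from this[OF Suc] show ?case by simp
qed

text \<open>
  The symmetric tensors need no separate treatment: \<open>a \<otimes> b + b \<otimes> a\<close> is \<open>\<eta>(a) \<eta>(b) - \<eta>(a_(-1) b)\<close>.
\<close>

lemma sym_tensor_in_etaFil:
  assumes "\<And>a. a \<in> Fil p \<Longrightarrow> eta vac a \<in> etaFil G p" "\<And>a. a \<in> Fil q \<Longrightarrow> eta vac a \<in> etaFil G q"
    and "\<And>a. a \<in> Fil (p + q) \<Longrightarrow> eta vac a \<in> etaFil G (p + q)"
    and "a \<in> Fil p" "b \<in> Fil q"
  shows "sym_tensor a b \<in> etaFil G (p + q)"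
proof -
  have "sym_tensor a b = tprod (-1) (eta vac a) (eta vac b) - eta vac (nprod (-1) a b)"
    by (simp add: eta_times_eta)
  also have "\<dots> \<in> etaFil G (p + q)"
    using assms nprod_in_Fil[of a p b q] by (intro etaFil_diff tprod_etaFil) auto
  finally show ?thesis .
qed

text \<open>
  Write \<open>[u | v]\<close> for \<open>u \<otimes> v + v \<otimes> u\<close> modulo what is already generated. Multiplying \<open>[b | c]\<close> by \<open>\<eta>(a)\<close>
  gives \<open>[a b | c] = - [b | a c]\<close>, and likewise for the other two choices of the multiplier. Since
  \<open>a b = b a\<close> and so on up to lower degree, the elements \<open>[a b | c]\<close>, \<open>[a c | b]\<close> and \<open>[b c | a]\<close> are
  pairwise negatives of each other, so that twice each of them is zero. The degrees have to be
  positive for the factors to have degree below \<open>p + q + l\<close>.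
\<close>

lemma eta_triple_product_in_etaFil:
  assumes IH: "\<And>k a. k < p + q + l \<Longrightarrow> a \<in> Fil k \<Longrightarrow> eta vac a \<in> etaFil G k"
    and pos: "p \<ge> 1" "q \<ge> 1" "l \<ge> 1"
    and abc: "a \<in> Fil p" "b \<in> Fil q" "c \<in> Fil l"
  shows "eta vac (nprod (-1) a (nprod (-1) b c)) \<in> etaFil G (p + q + l)"
proof -
  let ?B = "etaFil G (p + q + l)"
  have sym: "sym_tensor u v \<in> etaFil G (i + j)"
    if "i + j < p + q + l" "i < p + q + l" "j < p + q + l" "u \<in> Fil i" "v \<in> Fil j" for u v i j
    using that IH by (intro sym_tensor_in_etaFil) auto
  have product: "sym_tensor (nprod (-1) x y) z + sym_tensor y (nprod (-1) x z) \<in> ?B"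
    if "x \<in> Fil i" "y \<in> Fil j" "z \<in> Fil k" "i \<ge> 1" "j \<ge> 1" "k \<ge> 1" "i + j + k = p + q + l" for x y z i j k
  proof -
    have "eta vac x \<in> etaFil G i" "sym_tensor y z \<in> etaFil G (j + k)"
      using that pos by (auto intro!: IH sym)
    from tprod_etaFil[OF this] that(7) show ?thesis
      by (simp add: eta_times_sym_tensor add.assoc)
  qed
  have commute: "sym_tensor (nprod (-1) x y - nprod (-1) y x) z \<in> ?B"
    if "x \<in> Fil i" "y \<in> Fil j" "z \<in> Fil k" "i \<ge> 1" "j \<ge> 1" "k \<ge> 1" "i + j + k = p + q + l" for x y z i j k
    using sym[OF _ _ _ skew_symmetry_modulo_Fil[OF that(1,2)] that(3)] that pos
      etaFil_mono[of "i + j - 1 + k" "p + q + l" G] by auto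
  let ?ab = "nprod (-1) a b" and ?bc = "nprod (-1) b c" and ?ac = "nprod (-1) a c"
  have 1: "sym_tensor ?ab c + sym_tensor b ?ac \<in> ?B"
    using product[OF abc] pos by simp
  have 2: "sym_tensor (nprod (-1) b a) c + sym_tensor a ?bc \<in> ?B"
    using product[OF abc(2,1,3)] pos by simp
  have 3: "sym_tensor (nprod (-1) c a) b + sym_tensor a (nprod (-1) c b) \<in> ?B"
    using product[OF abc(3,1,2)] pos by simp
  have 4: "sym_tensor (?ab - nprod (-1) b a) c \<in> ?B"
    using commute[OF abc] pos by simp
  have 5: "sym_tensor (?ac - nprod (-1) c a) b \<in> ?B"
    using commute[OF abc(1,3,2)] pos by simp
  have 6: "sym_tensor (?bc - nprod (-1) c b) a \<in> ?B"
    using commute[OF abc(2,3,1)] pos by simp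
  \<comment> \<open>the relations 2 + 3 - 1, with the commutators in 4, 5, 6 restoring a common order\<close>
  have "(sym_tensor (nprod (-1) b a) c + sym_tensor a ?bc)
      + (sym_tensor (nprod (-1) c a) b + sym_tensor a (nprod (-1) c b))
      - (sym_tensor ?ab c + sym_tensor b ?ac)
      + sym_tensor (?ab - nprod (-1) b a) c + sym_tensor (?ac - nprod (-1) c a) b
      + sym_tensor (?bc - nprod (-1) c b) a = sym_tensor a ?bc + sym_tensor a ?bc"
    by (simp add: sym_tensor_def tensor_pair_linear algebra_simps)
  moreover have "(sym_tensor (nprod (-1) b a) c + sym_tensor a ?bc)
      + (sym_tensor (nprod (-1) c a) b + sym_tensor a (nprod (-1) c b))
      - (sym_tensor ?ab c + sym_tensor b ?ac)
      + sym_tensor (?ab - nprod (-1) b a) c + sym_tensor (?ac - nprod (-1) c a) b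
      + sym_tensor (?bc - nprod (-1) c b) a \<in> ?B"
    by (intro etaFil_add etaFil_diff 1 2 3 4 5 6)
  ultimately have "(1 / 2) *\<^sub>C (sym_tensor a ?bc + sym_tensor a ?bc) \<in> ?B"
    by (intro etaFil_scale) (simp only:)
  also have "(1 / 2) *\<^sub>C (sym_tensor a ?bc + sym_tensor a ?bc) = sym_tensor a ?bc"
    by (simp add: scaleC_add_right scaleC_add_left[symmetric] scaleC_one)
  finally have "sym_tensor a ?bc \<in> ?B" .
  moreover have "tprod (-1) (eta vac a) (eta vac ?bc) \<in> ?B"
  proof -
    have "eta vac a \<in> etaFil G p" "eta vac ?bc \<in> etaFil G (q + l)"
      using pos abc by (auto intro!: IH nprod_in_Fil)
    from tprod_etaFil[OF this] show ?thesis by (simp add: add.assoc)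
  qed
  ultimately have "tprod (-1) (eta vac a) (eta vac ?bc) - sym_tensor a ?bc \<in> ?B"
    by (rule etaFil_diff[rotated])
  then show ?thesis by (simp add: eta_times_eta)
qed

text \<open>
  As \<open>\<eta>\<close> maps the image of the translation operator into \<open>C2\<close>, the Leibniz rule trades a derivative on
  \<open>y\<close> for one on \<open>x\<close>, until \<open>y_(-1) vac = y\<close> is reached.
\<close>

lemma eta_generator_pair_in_span:
  assumes S: "csubspace S" "fixC2 \<subseteq> S" and xy: "\<And>n. n \<ge> 1 \<Longrightarrow> eta vac (nprod (- int n) x y) \<in> S"
    and "n \<ge> 1" "k \<ge> 1"
  shows "eta vac (nprod (- int n) x (nprod (- int k) y vac)) \<in> S"
  using assms(5,4)
proof (induction k arbitrary: n rule: dec_induct)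
  case base
  then show ?case using xy by (simp add: creation)
next
  case (step k)
  let ?t = "\<lambda>n k. eta vac (nprod (- int n) x (nprod (- int k) y vac))"
  note eta_lin = clinear_add[OF clinear_eta] clinear_scale[OF clinear_eta]
  have "eta vac (nprod (-2) (nprod (- int n) x (nprod (- int k) y vac)) vac) \<in> S"
    unfolding eta_nprod_vac using S(2) tprod_below_in_fixC2[OF eta_in_swap_fixed tvac_in_swap_fixed] by auto
  also have "eta vac (nprod (-2) (nprod (- int n) x (nprod (- int k) y vac)) vac) =
      of_nat n *\<^sub>C ?t (Suc n) k + of_nat k *\<^sub>C ?t n (Suc k)"
  proof -
    have "nprod (-2) (nprod (- int n) x (nprod (- int k) y vac)) vac =
        of_nat n *\<^sub>C nprod (- int (Suc n)) x (nprod (- int k) y vac)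
        + of_nat k *\<^sub>C nprod (- int n) x (nprod (- int (Suc k)) y vac)"
    proof -
      have "- int (Suc i) = - int i - 1" for i by simp
      then show ?thesis unfolding translation_pair by (simp only:) simp
    qed
    then show ?thesis by (simp only: eta_lin)
  qed
  finally have "of_nat n *\<^sub>C ?t (Suc n) k + of_nat k *\<^sub>C ?t n (Suc k) - of_nat n *\<^sub>C ?t (Suc n) k \<in> S"
    using step.IH[of "Suc n"] S(1)
    by (intro complex_vector.subspace_diff complex_vector.subspace_scale) auto
  then have "of_nat k *\<^sub>C ?t n (Suc k) \<in> S" by simp
  then have "(1 / of_nat k) *\<^sub>C (of_nat k *\<^sub>C ?t n (Suc k)) \<in> S"
    by (rule complex_vector.subspace_scale[OF S(1)])
  moreover have "(1 / of_nat k) *\<^sub>C (of_nat k *\<^sub>C ?t n (Suc k)) = ?t n (Suc k)"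
    using step.hyps by (simp only: scaleC_scaleC) (simp add: scaleC_one)
  ultimately show ?case by simp
qed

text \<open>
  Induction on the degree. Words with three or more letters split into three factors of positive degree;
  words with one or two letters are given by the hypotheses or vanish modulo \<open>C2\<close>.
\<close>

lemma eta_Fil_subset_etaFil:
  assumes gens: "\<And>x. x \<in> T \<Longrightarrow> (x, wt x) \<in> G"
    and pairs: "\<And>x y n. x \<in> T \<Longrightarrow> y \<in> T \<Longrightarrow> n \<ge> 1 \<Longrightarrow>
      eta vac (nprod (- int n) x y) \<in> etaFil G (int (wt x + wt y))"
    and a: "a \<in> Fil m"
  shows "eta vac a \<in> etaFil G m"
proof -
  have "eta vac a \<in> etaFil G m" if "m < int k" "a \<in> Fil m" for k m a
    using that
  proof (induction k arbitrary: m a)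
    case 0
    then have "a = 0" using Fil_negative[of m] by simp
    then show ?case by (simp add: clinear_0[OF clinear_eta] etaFil_0)
  next
    case (Suc k)
    have mono: "eta vac (monomial xs) \<in> etaFil G m"
      if xs: "set xs \<subseteq> T \<times> {1..}" and deg: "int (degree xs) \<le> m" for xs
    proof -
      consider "xs = []" | x n where "xs = [(x, n)]" | x n y k where "xs = [(x, n), (y, k)]"
        | x n y k z l zs where "xs = (x, n) # (y, k) # (z, l) # zs"
        by (cases xs rule: remdups_adj.cases) (auto, metis neq_Nil_conv surj_pair)
      then show ?thesis
      proof cases
        case 1
        then have "tvac \<in> etaFil G m"
          using etaprod_in_etaFil[of "[]" G m] deg by simp
        then show ?thesis by (simp add: 1 eta_def etaFil_add)
      next
        case 2
        then have x: "x \<in> T" "n \<ge> 1" "int (wt x) \<le> m" using xs deg by auto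
        show ?thesis
        proof (cases "n = 1")
          case True
          then show ?thesis using eta_in_etaFil[OF gens[OF x(1)] x(3)] by (simp add: 2 creation)
        next
          case False
          then have "eta vac (monomial xs) \<in> fixC2"
            unfolding 2 monomial_simps eta_nprod_vac using x(2)
            by (intro tprod_below_in_fixC2 eta_in_swap_fixed tvac_in_swap_fixed) auto
          then show ?thesis using fixC2_subset_etaFil by auto
        qed
      next
        case 3
        then have xy: "x \<in> T" "y \<in> T" "n \<ge> 1" "k \<ge> 1" "int (wt x + wt y) \<le> m" using xs deg by auto
        have "eta vac (monomial xs) \<in> etaFil G (int (wt x + wt y))"
          unfolding 3 monomial_simps using xy pairs
          by (intro eta_generator_pair_in_span csubspace_etaFil fixC2_subset_etaFil)
        then show ?thesis using etaFil_mono[OF xy(5)] by auto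
      next
        case 4
        let ?c = "monomial ((z, l) # zs)" and ?d = "degree ((z, l) # zs)"
        have xy: "x \<in> T" "y \<in> T" "n \<ge> 1" "k \<ge> 1" "z \<in> T" "set ((z, l) # zs) \<subseteq> T \<times> {1..}"
          using 4 xs by auto
        have c: "?c \<in> Fil (int ?d)" "int ?d \<ge> 1"
          using monomial_in_Fil[OF xy(6) order_refl] wt_pos[OF xy(5)] by auto
        have X: "nprod (- int n) x vac \<in> Fil (int (wt x))" "nprod (- int k) y vac \<in> Fil (int (wt y))"
          using generator_nprod_in_Fil[OF xy(1) _ vac_in_Fil[OF order_refl], of "- int n"]
            generator_nprod_in_Fil[OF xy(2) _ vac_in_Fil[OF order_refl], of "- int k"] xy by auto
        have m: "int (wt x) + int (wt y) + int ?d \<le> m" using deg 4 by simp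
        have "monomial xs = nprod (-1) (nprod (- int n) x vac) (nprod (-1) (nprod (- int k) y vac) ?c)"
          using nprod_creation_field[of "int n" x] nprod_creation_field[of "int k" y] xy(3,4)
          by (simp add: 4)
        also have "eta vac \<dots> \<in> etaFil G (int (wt x) + int (wt y) + int ?d)"
        proof (rule eta_triple_product_in_etaFil[OF _ _ _ c(2) X c(1)])
          show "eta vac a \<in> etaFil G j" if "j < int (wt x) + int (wt y) + int ?d" "a \<in> Fil j" for j a
            using that m Suc.prems(1) by (intro Suc.IH) auto
        qed (use wt_pos xy in auto)
        finally show ?thesis using etaFil_mono[OF m] by auto
      qed
    qed
    from Suc.prems(2) show ?case
    proof (induction rule: Fil_induct)
      case zero
      show ?case by (simp add: clinear_0[OF clinear_eta] etaFil_0)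
    next
      case (step c xs b)
      with mono show ?case
        by (simp add: clinear_add[OF clinear_eta] clinear_scale[OF clinear_eta] etaFil_add etaFil_scale)
    qed
  qed
  from this[of m "nat (m + 1)"] a show ?thesis
    by (cases "m \<ge> 0") (auto simp: Fil_negative clinear_0[OF clinear_eta] etaFil_0)
qed

lemma Fil_exhaustive: "\<exists>p. a \<in> Fil p"
proof -
  have "a \<in> cspan {monomial xs | xs. set xs \<subseteq> T \<times> {1..}}"
    using generated by (simp add: strongly_generated_def monomial_def)
  then show ?thesis
  proof (induction rule: complex_vector.span_induct_alt)
    case base
    show ?case using Fil_0 by blast
  next
    case (step c x y)
    then obtain xs p where x: "x = monomial xs" "set xs \<subseteq> T \<times> {1..}" and y: "y \<in> Fil p" by blast
    have "x \<in> Fil (max p (int (degree xs)))" unfolding x(1) by (rule monomial_in_Fil[OF x(2)]) simp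
    moreover have "y \<in> Fil (max p (int (degree xs)))"
      using y Fil_mono[of p "max p (int (degree xs))"] by auto
    ultimately show ?case using Fil_add Fil_scale by blast
  qed
qed

text \<open>
  The finite set \<open>G\<close> of generators consists of \<open>T\<close> and, for each pair \<open>x, y\<close>, of finitely many \<open>x_(-n) y\<close>
  whose images span those of all of them. Choosing them pair by pair ensures that each \<open>\<eta>(x_(-n) y)\<close> is
  a combination of generators of the same degree \<open>wt x + wt y\<close>.
\<close>

lemma fixed_points_C2_cofinite:
  assumes cofinite: "C2_cofinite nprod UNIV" and T: "finite T"
    and pairs: "finite F" "{eta vac (nprod (- int n) x y) | x y n. x \<in> T \<and> y \<in> T \<and> n \<ge> 1} \<subseteq> cspan (fixC2 \<union> F)"
  shows "C2_cofinite tprod swap_fixed"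
proof -
  define P where "P x y = {nprod (- int n) x y | n. n \<ge> 1}" for x y
  define spans where "spans x y E \<longleftrightarrow> finite E \<and> E \<subseteq> P x y \<and>
      eta vac ` P x y \<subseteq> cspan (fixC2 \<union> eta vac ` E)" for x y E
  have "\<exists>E. spans x y E" if "x \<in> T" "y \<in> T" for x y
  proof -
    have "eta vac ` P x y \<subseteq> {eta vac (nprod (- int n) x y) | x y n. x \<in> T \<and> y \<in> T \<and> n \<ge> 1}"
      using that by (auto simp: P_def)
    from finite_spanning_subset_modulo[OF pairs(1) order_trans[OF this pairs(2)]]
    obtain A' where A': "finite A'" "A' \<subseteq> eta vac ` P x y" "eta vac ` P x y \<subseteq> cspan (fixC2 \<union> A')"
      by blast
    from finite_subset_image[OF A'(1,2)] obtain E where "E \<subseteq> P x y" "finite E" "A' = eta vac ` E"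
      by blast
    with A'(3) have "spans x y E" by (simp add: spans_def)
    then show ?thesis ..
  qed
  then obtain E where E: "\<And>x y. x \<in> T \<Longrightarrow> y \<in> T \<Longrightarrow> spans x y (E x y)"
    by metis
  define G where "G = (\<lambda>x. (x, wt x)) ` T \<union> (\<Union>x\<in>T. \<Union>y\<in>T. (\<lambda>a. (a, wt x + wt y)) ` E x y)"
  have G: "finite G" using T E by (auto simp: G_def spans_def)
  have G_cases: "a \<in> Fil (int d) \<and> (\<exists>k. nth_power a k \<in> Fil (int k * int d - 1))" if ad: "(a, d) \<in> G" for a d
  proof -
    from ad consider "a \<in> T" "d = wt a"
      | x y where "x \<in> T" "y \<in> T" "a \<in> E x y" "d = wt x + wt y"
      unfolding G_def by auto
    then show ?thesis
    proof cases
      case 1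
      then show ?thesis
        using generator_in_Fil[OF 1(1)] generator_nilpotent_modulo_Fil[OF cofinite 1(1)] by simp
    next
      case (2 x y)
      have "a \<in> P x y" using E[OF 2(1,2)] 2(3) unfolding spans_def by blast
      then obtain n where n: "a = nprod (- int n) x y" "n \<ge> 1" unfolding P_def by blast
      have "a \<in> Fil (int d)"
        using generator_nprod_in_Fil[OF 2(1) _ generator_in_Fil[OF 2(2)], of "- int n"] n
        by (simp add: 2(4))
      then show ?thesis
        using generator_pair_nilpotent_modulo_Fil[OF cofinite 2(1,2) n(2)] by (simp only: n(1) 2(4) simp_thms)
    qed
  qed
  have "\<exists>k. \<forall>(a, d)\<in>G. nth_power a k \<in> Fil (int k * int d - 1)"
  proof -
    from G_cases have "\<forall>g\<in>G. \<exists>k. nth_power (fst g) k \<in> Fil (int k * int (snd g) - 1)" by auto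
    then obtain k where k: "\<And>g. g \<in> G \<Longrightarrow> nth_power (fst g) (k g) \<in> Fil (int (k g) * int (snd g) - 1)"
      by metis
    have "nth_power (fst g) (Max (k ` G)) \<in> Fil (int (Max (k ` G)) * int (snd g) - 1)" if "g \<in> G" for g
      by (rule nth_power_beyond[OF _ k[OF that]]) (use that G G_cases[of "fst g" "snd g"] in auto)
    then show ?thesis by (intro exI[of _ "Max (k ` G)"]) auto
  qed
  then obtain k where k: "\<And>a d. (a, d) \<in> G \<Longrightarrow> nth_power a k \<in> Fil (int k * int d - 1)" by blast
  have eta_Fil: "eta vac a \<in> etaFil G m" if "a \<in> Fil m" for a m
  proof (rule eta_Fil_subset_etaFil[OF _ _ that])
    show "(x, wt x) \<in> G" if "x \<in> T" for x using that by (simp add: G_def)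
    show "eta vac (nprod (- int n) x y) \<in> etaFil G (int (wt x + wt y))"
      if xy: "x \<in> T" "y \<in> T" "n \<ge> 1" for x y n
    proof -
      have "eta vac (nprod (- int n) x y) \<in> eta vac ` P x y"
        unfolding P_def using xy(3) by (intro imageI CollectI exI[of _ n]) simp
      then have in_span: "eta vac (nprod (- int n) x y) \<in> cspan (fixC2 \<union> eta vac ` E x y)"
        using E[OF xy(1,2)] by (auto simp: spans_def)
      have "(a, wt x + wt y) \<in> G" if "a \<in> E x y" for a
        using that xy by (auto simp: G_def)
      then have "fixC2 \<union> eta vac ` E x y \<subseteq> etaFil G (int (wt x + wt y))"
        by (intro Un_least fixC2_subset_etaFil image_subsetI) (rule eta_in_etaFil[OF _ order_refl])
      then have "cspan (fixC2 \<union> eta vac ` E x y) \<subseteq> etaFil G (int (wt x + wt y))"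
        by (rule complex_vector.span_minimal) simp
      from subsetD[OF this in_span] show ?thesis .
    qed
  qed
  have sym: "sym_tensor a b \<in> etaFil G (p + q)" if "a \<in> Fil p" "b \<in> Fil q" for a b p q
    using that by (intro sym_tensor_in_etaFil eta_Fil)
  have nil: "etaprod (replicate (2 * k) (a, d)) \<in> etaFil G (int (2 * k * d) - 1)" if ad: "(a, d) \<in> G" for a d
  proof -
    have a: "a \<in> Fil (int d)" using G_cases[OF ad] by blast
    \<comment> \<open>of the two powers in a summand, one has an exponent of at least \<open>k\<close>\<close>
    have half: "sym_tensor (nth_power a i) (nth_power a j) \<in> etaFil G (int (2 * k * d) - 1)"
      if "i + j = 2 * k" "i \<ge> k" for i j
    proof -
      have "sym_tensor (nth_power a i) (nth_power a j) \<in> etaFil G ((int i * int d - 1) + int j * int d)"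
        by (intro sym nth_power_beyond[OF a k[OF ad] that(2)] nth_power_in_Fil[OF a])
      also have "(int i * int d - 1) + int j * int d = int ((i + j) * d) - 1"
        by (simp add: algebra_simps)
      finally show ?thesis using that(1) by simp
    qed
    have "sym_tensor (nth_power a i) (nth_power a j) \<in> etaFil G (int (2 * k * d) - 1)"
      if "i + j = 2 * k" for i j
    proof (cases "i \<ge> k")
      case True
      with that show ?thesis by (rule half)
    next
      case False
      then show ?thesis using half[of j i] that by (simp add: sym_tensor_commute add.commute)
    qed
    then have "cspan {sym_tensor (nth_power a i) (nth_power a j) | i j. i + j = 2 * k} \<subseteq> etaFil G (int (2 * k * d) - 1)"
      by (intro complex_vector.span_minimal) auto
    then show ?thesis using etaprod_replicate_in_span by (rule subsetD)
  qed
  let ?L = "{xs. set xs \<subseteq> G \<and> length xs \<le> card G * (2 * k)}"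
  have "swap_fixed \<subseteq> cspan (fixC2 \<union> etaprod ` ?L)"
  proof -
    have "sym_tensor a b \<in> cspan (fixC2 \<union> etaprod ` ?L)" for a b
    proof -
      obtain p q where "a \<in> Fil p" "b \<in> Fil q" using Fil_exhaustive by meson
      from subsetD[OF etaFil_finite_modulo_C2[OF G nil] sym[OF this]] show ?thesis .
    qed
    then have "cspan {sym_tensor a b | a b. True} \<subseteq> cspan (fixC2 \<union> etaprod ` ?L)"
      by (intro complex_vector.span_minimal) auto
    then show ?thesis using swap_fixed_spanned_by_sym_tensors by (rule order_trans[rotated])
  qed
  moreover have "finite (etaprod ` ?L)"
    by (intro finite_imageI finite_lists_length_le G)
  ultimately show ?thesis
    unfolding C2_cofinite_iff[OF csubspace_swap_fixed] by blast
qed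

end

theorem theorem4p1:
  fixes nprod :: "int \<Rightarrow> 'a::complex_vector \<Rightarrow> 'a \<Rightarrow> 'a"
    and vac conf :: 'a
    and T :: "'a set"
  assumes "vertex_operator_algebra nprod vac conf"
    and "C2_cofinite nprod UNIV"
    and "simple_voa nprod"
    and "CFT_type nprod vac conf"
    and "finite T"
    and "T \<subseteq> (\<Union>d\<in>{1..}. weight_space nprod conf d)"
    and "strongly_generated nprod vac T"
  shows "C2_cofinite (tensor_nprod nprod) swap_fixed \<longleftrightarrow>
    quotient_finite_dim (C2 (tensor_nprod nprod) swap_fixed)
      (quotient_span (C2 (tensor_nprod nprod) swap_fixed)
        {eta_bar nprod vac (nprod (- int n) x y) | x y n. x \<in> T \<and> y \<in> T \<and> n \<ge> 1})"
proof -
  let ?U = "C2 (tensor_nprod nprod) swap_fixed"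
  let ?A = "{eta vac (nprod (- int n) x y) | x y n. x \<in> T \<and> y \<in> T \<and> n \<ge> 1}"
  have "\<forall>x\<in>T. \<exists>d. d \<ge> 1 \<and> x \<in> weight_space nprod conf d"
    using assms(6) by auto
  then obtain wt where "\<And>x. x \<in> T \<Longrightarrow> wt x \<ge> 1 \<and> x \<in> weight_space nprod conf (wt x)"
    by metis
  then interpret strongly_generated_voa nprod vac conf T wt
    using assms by (intro strongly_generated_voa.intro strongly_generated_voa_axioms.intro) auto
  have "{eta_bar nprod vac (nprod (- int n) x y) | x y n. x \<in> T \<and> y \<in> T \<and> n \<ge> 1} = (\<lambda>a. a +o ?U) ` ?A"
    by (auto simp: eta_bar_def)
  then have "quotient_finite_dim ?U (quotient_span ?U
        {eta_bar nprod vac (nprod (- int n) x y) | x y n. x \<in> T \<and> y \<in> T \<and> n \<ge> 1})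
      \<longleftrightarrow> (\<exists>F. finite F \<and> ?A \<subseteq> cspan (?U \<union> F))"
    by (simp add: quotient_finite_dim_span_iff[OF csubspace_C2])
  moreover have "C2_cofinite (tensor_nprod nprod) swap_fixed \<longleftrightarrow> (\<exists>F. finite F \<and> ?A \<subseteq> cspan (?U \<union> F))"
  proof
    have "?A \<subseteq> swap_fixed" using eta_in_swap_fixed by auto
    then show "\<exists>F. finite F \<and> ?A \<subseteq> cspan (?U \<union> F)" if "C2_cofinite (tensor_nprod nprod) swap_fixed"
      using that unfolding C2_cofinite_iff[OF csubspace_swap_fixed] by (meson order_trans)
    show "C2_cofinite (tensor_nprod nprod) swap_fixed" if "\<exists>F. finite F \<and> ?A \<subseteq> cspan (?U \<union> F)"
      using that fixed_points_C2_cofinite[OF assms(2,5)] by blast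
  qed
  ultimately show ?thesis by simp
qed

end
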